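(* Let $F \subset \mathbb{R}$ be a self-conformal set containing at least two points. If $F$ does not satisfy the identity limit criterion, then $\dim_{\mathrm{A}}(F)=1$.
   Context: Self-conformal sets in $\mathbb{R}$: a map on an open set $\Omega\subset\mathbb{R}$ is conformal if it is $C^1$ with non-vanishing derivative and there exist $\alpha,c>0$ with $|\varphi'(x) - \varphi'(y)| \le c|x-y|^\alpha$ for all $x,y \in \Omega$. A finite family $\{\varphi_i\}_{i=1}^N$, $N \ge 2$, is a conformal iterated function system if each $\varphi_i$ is an injective conformal mapping on a common non-empty bounded open convex set (interval) $\Omega \subset \mathbb{R}$ such that $\overline{\varphi_i(\Omega)} \subset \Omega$ and $\|\varphi_i'\| := \sup_{x \in \Omega}|\varphi_i'(x)| < 1$. The associated self-conformal set is the unique non-empty compact set $F \subset \Omega$ with $F = \bigcup_{i=1}^N \varphi_i(F)$. A self-conformal set always comes with a fixed conformal iterated function system defining it. Words: $\Sigma_*$ is the set of all finite words (including the empty word $\varnothing$) over $\{1,\dots,N\}$. For $\mathtt{i}=i_1\cdots i_n$, $\varphi_{\mathtt{i}} = \varphi_{i_1}\circ\cdots\circ\varphi_{i_n}$, with $\varphi_\varnothing$ the identity, and $\|\varphi_{\mathtt{i}}'\| = \sup_{x\in\Omega}|\varphi_{\mathtt{i}}'(x)|$. Identity limit criterion: $\inf\{ \|\varphi_{\mathtt{i}}'\|^{-1} \sup_{x \in F}|\varphi_{\mathtt{i}}(x)-\varphi_{\mathtt{j}}(x)| : \mathtt{i},\mathtt{j} \in \Sigma_* \text{ such that } \varphi_{\mathtt{i}}|_F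 \ne \varphi_{\mathtt{j}}|_F \} > 0$. Assouad dimension: $\dim_{\mathrm{A}}(A)$ is the infimum of all $s$ for which there exists a constant $C \ge 1$ such that each set $A \cap B(x,R)$ can be covered by at most $C(R/r)^s$ balls of radius $r$ centred in $A$, for all $0<r<R$. *)

theory Defs
  imports "HOL-Analysis.Analysis"
begin

(* Maps on \<Omega> are total functions on the reals whose values outside \<Omega> play no role;
   since \<Omega> is open, deriv at a point of \<Omega> does not see them either. *)

definition conformal_on :: "real set \<Rightarrow> (real \<Rightarrow> real) \<Rightarrow> bool" where
  "conformal_on \<Omega> f \<longleftrightarrow>
     open \<Omega> \<and> f C1_differentiable_on \<Omega> \<and> (\<forall>x\<in>\<Omega>. deriv f x \<noteq> 0) \<and>
     (\<exists>\<alpha> c. \<alpha> > 0 \<and> c > 0 \<and>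
        (\<forall>x\<in>\<Omega>. \<forall>y\<in>\<Omega>. \<bar>deriv f x - deriv f y\<bar> \<le> c * \<bar>x - y\<bar> powr \<alpha>))"

(* The supremum is taken in the reals. For conformal maps on a bounded \<Omega> the Hoelder condition
   bounds the derivative, so it is a genuine supremum. *)
definition deriv_norm :: "real set \<Rightarrow> (real \<Rightarrow> real) \<Rightarrow> real" where
  "deriv_norm \<Omega> f = (SUP x\<in>\<Omega>. \<bar>deriv f x\<bar>)"

definition conformal_IFS :: "nat \<Rightarrow> real set \<Rightarrow> (nat \<Rightarrow> real \<Rightarrow> real) \<Rightarrow> bool" where
  "conformal_IFS N \<Omega> \<phi> \<longleftrightarrow>
     N \<ge> 2 \<and> \<Omega> \<noteq> {} \<and> bounded \<Omega> \<and> open \<Omega> \<and> convex \<Omega> \<and>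
     (\<forall>i\<in>{1..N}. conformal_on \<Omega> (\<phi> i) \<and> inj_on (\<phi> i) \<Omega> \<and>
        closure (\<phi> i ` \<Omega>) \<subseteq> \<Omega> \<and> deriv_norm \<Omega> (\<phi> i) < 1)"

(* For a conformal IFS these conditions determine F uniquely. *)
definition self_conformal_set ::
  "nat \<Rightarrow> real set \<Rightarrow> (nat \<Rightarrow> real \<Rightarrow> real) \<Rightarrow> real set \<Rightarrow> bool" where
  "self_conformal_set N \<Omega> \<phi> F \<longleftrightarrow>
     conformal_IFS N \<Omega> \<phi> \<and> F \<noteq> {} \<and> compact F \<and> F \<subseteq> \<Omega> \<and>
     F = (\<Union>i\<in>{1..N}. \<phi> i ` F)"

definition words :: "nat \<Rightarrow> nat list set" where
  "words N = lists {1..N}"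

fun word_map :: "(nat \<Rightarrow> real \<Rightarrow> real) \<Rightarrow> nat list \<Rightarrow> real \<Rightarrow> real" where
  "word_map \<phi> [] = id"
| "word_map \<phi> (i # u) = \<phi> i \<circ> word_map \<phi> u"

(* The infimum is taken in ereal, so that it is +\<infinity> for an empty index set. *)
definition identity_limit_criterion ::
  "nat \<Rightarrow> real set \<Rightarrow> (nat \<Rightarrow> real \<Rightarrow> real) \<Rightarrow> real set \<Rightarrow> bool" where
  "identity_limit_criterion N \<Omega> \<phi> F \<longleftrightarrow>
     Inf {ereal (inverse (deriv_norm \<Omega> (word_map \<phi> u)) *
                 (SUP x\<in>F. \<bar>word_map \<phi> u x - word_map \<phi> v x\<bar>)) | u v.
            u \<in> words N \<and> v \<in> words N \<and>
            restrict (word_map \<phi> u) F \<noteq> restrict (word_map \<phi> v) F} > 0"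

(* Balls are closed, and x ranges over the whole ambient space; taking open balls or only x in A
   changes nothing but the constant C. Valued in ereal because no exponent s need be admissible. *)
definition assouad_dim :: "'a::metric_space set \<Rightarrow> ereal" where
  "assouad_dim A = Inf {ereal s | s.
     \<exists>C\<ge>1. \<forall>x r R. 0 < r \<and> r < R \<longrightarrow>
       (\<exists>K. finite K \<and> K \<subseteq> A \<and> real (card K) \<le> C * (R / r) powr s \<and>
            A \<inter> cball x R \<subseteq> (\<Union>y\<in>K. cball y r))}"

end

(* The failure of the criterion yields words u, v whose maps differ on F by a tiny amount relative
   to their contraction. Hoelder control of the derivatives keeps phi_v - phi_u almost constant on a
   cylinder around a point of maximal difference, and this cylinder is much larger than the relative
   difference; shrinking it suitably gives, for every t in (0,1], words i, j with phi_j - phi_i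
   positive and comparable on all of F to t times the contraction of phi_i. Hence a chain of points
   p_0 < ... < p_n of F with gaps of comparable size Delta extends to phi_i(p_0) < ... < phi_i(p_n)
   < phi_j(p_n), with t = Delta; by bounded distortion the constants do not deteriorate. So F
   contains arbitrarily long approximate arithmetic progressions, which forces dimension one. *)

theory Submission
  imports Defs
begin

section \<open>Assouad dimension on the line\<close>

text \<open>The obstacle is that the criterion speaks only about values on F, while keeping a
  difference nearly constant needs control of its derivative. Smallness is transferred by
  interpolation, all sizes being relative to the contraction: a difference of size \<delta> on F has
  a mean slope of order \<delta>/D between two points of F at distance about D, and the Hoelder
  bound adds a term of order D^\<alpha> elsewhere at that scale. The two terms balance when
  D^(1+\<alpha>) = \<delta>. Then D is a fractional power of \<delta>, hence much larger than
  \<delta>, and a cylinder of size \<delta>/t still fits far inside the one of size D once \<delta>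
  is small in terms of t. Arbitrary t is essential because the spacing of a chain shrinks by an
  uncontrolled factor at each extension, and the next pair of words has to match it. A second
  obstacle is orientation: the inner map must keep the order of the chain.\<close>

lemma gaps_lower:
  fixes p :: "nat \<Rightarrow> real"
  assumes "\<And>k. k < n \<Longrightarrow> g \<le> p (Suc k) - p k" "k \<le> l" "l \<le> n"
  shows "real (l - k) * g \<le> p l - p k"
  using assms(2,3)
proof (induction l rule: dec_induct)
  case (step l)
  then have "real (l - k) * g \<le> p l - p k" "g \<le> p (Suc l) - p l" using assms(1) by auto
  then show ?case using step by (simp add: Suc_diff_le algebra_simps)
qed auto

lemma gaps_upper:
  fixes p :: "nat \<Rightarrow> real"
  assumes "\<And>k. k < n \<Longrightarrow> p (Suc k) - p k \<le> g" "k \<le> n"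
  shows "p k - p 0 \<le> real k * g"
  using assms(2)
proof (induction k)
  case (Suc k)
  then have "p (Suc k) - p k \<le> g" "p k - p 0 \<le> real k * g" using assms(1) by auto
  then show ?case by (simp add: algebra_simps)
qed auto

text \<open>With r a third of the smallest admissible gap, a ball of radius r contains at most one
  chain point, while the whole chain lies in a ball whose radius is of order n * r. An admissible
  exponent s thus satisfies n \<le> const * n^s for every n, which excludes s < 1.\<close>

lemma assouad_dim_ge_1:
  fixes F :: "real set"
  assumes a: "0 < a" and ab: "a \<le> b"
    and chain: "\<And>n. \<exists>\<Delta>>0. \<exists>p. (\<forall>k\<le>n. p k \<in> F) \<and>
      (\<forall>k<n. a * \<Delta> \<le> p (Suc k) - p k \<and> p (Suc k) - p k \<le> b * \<Delta>)"
  shows "1 \<le> assouad_dim F"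
  unfolding assouad_dim_def
proof (rule Inf_greatest, clarify)
  fix s C :: real
  assume C: "1 \<le> C" and cover: "\<forall>x r R. 0 < r \<and> r < R \<longrightarrow>
    (\<exists>K. finite K \<and> K \<subseteq> F \<and> real (card K) \<le> C * (R / r) powr s \<and> F \<inter> cball x R \<subseteq> (\<Union>y\<in>K. cball y r))"
  have bound: "real n \<le> C * (3 * b / a * real n) powr s" if n: "0 < n" for n
  proof -
    obtain \<Delta> p where D: "\<Delta> > 0" and pF: "\<And>k. k \<le> n \<Longrightarrow> p k \<in> F"
      and gap: "\<And>k. k < n \<Longrightarrow> a * \<Delta> \<le> p (Suc k) - p k" "\<And>k. k < n \<Longrightarrow> p (Suc k) - p k \<le> b * \<Delta>"
      using chain[of n] by blast
    define r R where "r = a * \<Delta> / 3" and "R = b * \<Delta> * real n"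
    have r: "0 < r" unfolding r_def using a D by simp
    have "a * \<Delta> * 1 \<le> b * \<Delta> * real n" using ab a D n by (intro mult_mono) auto
    then have rR: "r < R" unfolding r_def R_def using mult_pos_pos[OF a D] by linarith
    obtain K where K: "finite K" "real (card K) \<le> C * (R / r) powr s"
      "F \<inter> cball (p 0) R \<subseteq> (\<Union>y\<in>K. cball y r)"
      using cover[rule_format, of r R "p 0"] r rR by blast
    have "\<exists>y\<in>K. \<bar>y - p k\<bar> \<le> r" if k: "k \<le> n" for k
    proof -
      have "0 \<le> p k - p 0" using gaps_lower[of n "a * \<Delta>" p 0 k] gap k mult_pos_pos[OF a D]
        by (smt (verit) mult_nonneg_nonneg of_nat_0_le_iff zero_le)
      moreover have "p k - p 0 \<le> real k * (b * \<Delta>)" using gaps_upper[of n p "b * \<Delta>" k] gap k by simp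
      moreover have "real k * (b * \<Delta>) \<le> real n * (b * \<Delta>)"
        using k a ab D by (intro mult_right_mono) auto
      ultimately have "p k \<in> F \<inter> cball (p 0) R"
        using pF[OF k] by (auto simp: dist_real_def R_def mult_ac)
      then have "p k \<in> (\<Union>y\<in>K. cball y r)" using K(3) by blast
      then show ?thesis by (auto simp: dist_real_def)
    qed
    then obtain f where f: "\<And>k. k \<le> n \<Longrightarrow> f k \<in> K \<and> \<bar>f k - p k\<bar> \<le> r" by metis
    have "inj_on f {..n}"
    proof (rule linorder_inj_onI)
      fix k l assume kl: "k < l" "k \<in> {..n}" "l \<in> {..n}"
      have "1 * (a * \<Delta>) \<le> real (l - k) * (a * \<Delta>)"
        using kl mult_pos_pos[OF a D] by (intro mult_right_mono) auto
      also have "\<dots> \<le> p l - p k" by (rule gaps_lower[of n]) (use gap kl in auto)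
      finally have "3 * r \<le> p l - p k" by (simp add: r_def)
      moreover have "\<bar>f k - p k\<bar> \<le> r" "\<bar>f l - p l\<bar> \<le> r" using f kl by auto
      ultimately show "f k \<noteq> f l" using r by linarith
    qed auto
    then have "card {..n} \<le> card K"
      using f by (intro card_inj_on_le[of f] K(1)) auto
    then have "real n \<le> C * (R / r) powr s" using K(2) by simp
    also have "R / r = 3 * b / a * real n" unfolding R_def r_def using a D by (simp add: field_simps)
    finally show ?thesis .
  qed
  show "(1::ereal) \<le> ereal s"
  proof (rule ccontr)
    assume "\<not> (1::ereal) \<le> ereal s"
    then have s: "s < 1" by (simp add: one_ereal_def)
    define Q where "Q = C * (3 * b / a) powr s"
    have "((\<lambda>n. real n powr (s - 1)) \<longlongrightarrow> 0) sequentially"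
      by (rule tendsto_neg_powr[OF _ filterlim_real_sequentially]) (use s in simp)
    from order_tendstoD(2)[OF tendsto_mult_right_zero[OF this, of Q] zero_less_one]
    have "\<forall>\<^sub>F n in sequentially. Q * real n powr (s - 1) < 1" .
    from eventually_conj[OF eventually_gt_at_top[of "0::nat"] this]
    obtain n :: nat where n: "0 < n" "Q * real n powr (s - 1) < 1"
      by (auto simp: eventually_sequentially)
    have "real n \<le> Q * real n powr s" 
      using bound[OF n(1)] powr_mult[of "3 * b / a" "real n" s] a ab
      by (simp only: Q_def mult.assoc)
    also have "\<dots> = (Q * real n powr (s - 1)) * real n" using n(1) by (simp add: powr_diff)
    also have "\<dots> < 1 * real n" using n by (intro mult_strict_right_mono) auto
    finally show False by simp
  qed
qed

text \<open>The centres have to lie in F, so one point of F is picked from each occupied cell of a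
  grid of mesh r; points of the same cell are at distance less than r. At most 2R/r + 2 cells meet
  the ball, and r < R absorbs the 2.\<close>

lemma assouad_dim_le_1:
  fixes F :: "real set"
  shows "assouad_dim F \<le> 1"
proof -
  have "\<exists>K. finite K \<and> K \<subseteq> F \<and> real (card K) \<le> 4 * (R / r) powr 1 \<and>
        F \<inter> cball x R \<subseteq> (\<Union>y\<in>K. cball y r)" if r: "0 < r" "r < R" for x r R
  proof -
    define h where "h = (\<lambda>y. \<lfloor>(y - x) / r\<rfloor>)"
    define S where "S = F \<inter> cball x R"
    define g where "g = inv_into S h"
    have hS: "h ` S \<subseteq> {\<lfloor>- (R / r)\<rfloor>..\<lfloor>R / r\<rfloor>}"
    proof clarify
      fix y assume "y \<in> S"
      then have "\<bar>y - x\<bar> \<le> R" unfolding S_def by (auto simp: dist_real_def)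
      then have "- R \<le> y - x" "y - x \<le> R" by auto
      then have "- R / r \<le> (y - x) / r" "(y - x) / r \<le> R / r"
        using r by (intro divide_right_mono; simp)+
      then show "h y \<in> {\<lfloor>- (R / r)\<rfloor>..\<lfloor>R / r\<rfloor>}" unfolding h_def by (auto intro!: floor_mono)
    qed
    then have fin: "finite (h ` S)" by (rule finite_subset) simp
    have "card (g ` h ` S) \<le> card (h ` S)" by (rule card_image_le[OF fin])
    also have "\<dots> \<le> card {\<lfloor>- (R / r)\<rfloor>..\<lfloor>R / r\<rfloor>}" by (rule card_mono[OF _ hS]) simp
    also have "\<dots> = nat (\<lfloor>R / r\<rfloor> - \<lfloor>- (R / r)\<rfloor> + 1)" by simp
    finally have "real (card (g ` h ` S)) \<le> real (nat (\<lfloor>R / r\<rfloor> - \<lfloor>- (R / r)\<rfloor> + 1))"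
      by (rule of_nat_mono)
    also have "\<dots> \<le> 2 * (R / r) + 2"
    proof -
      have "\<lfloor>- (R / r)\<rfloor> \<le> \<lfloor>R / r\<rfloor>" using r by (intro floor_mono) (simp add: field_simps)
      then show ?thesis by linarith
    qed
    also have "\<dots> \<le> 4 * (R / r) powr 1" using r by (simp add: field_simps)
    finally have card: "real (card (g ` h ` S)) \<le> 4 * (R / r) powr 1" .
    have sub: "g ` h ` S \<subseteq> S" unfolding g_def by (auto intro: inv_into_into)
    have "y \<in> (\<Union>y\<in>g ` h ` S. cball y r)" if y: "y \<in> S" for y
    proof -
      have "h (g (h y)) = h y" unfolding g_def by (rule f_inv_into_f) (use y in auto)
      then have "\<bar>(g (h y) - x) / r - (y - x) / r\<bar> \<le> 1" unfolding h_def by linarith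
      moreover have "(g (h y) - x) / r - (y - x) / r = (g (h y) - y) / r" using r by (simp add: field_simps)
      ultimately have "\<bar>g (h y) - y\<bar> \<le> r" using r by (simp add: field_simps)
      then show ?thesis using y by (auto simp: dist_real_def)
    qed
    then have "S \<subseteq> (\<Union>y\<in>g ` h ` S. cball y r)" by blast
    moreover have "g ` h ` S \<subseteq> F" using sub unfolding S_def by blast
    ultimately show ?thesis using finite_imageI[OF fin, of g] card unfolding S_def by blast
  qed
  then have "ereal 1 \<in> {ereal s | s. \<exists>C\<ge>1. \<forall>x r R. 0 < r \<and> r < R \<longrightarrow>
      (\<exists>K. finite K \<and> K \<subseteq> F \<and> real (card K) \<le> C * (R / r) powr s \<and>
        F \<inter> cball x R \<subseteq> (\<Union>y\<in>K. cball y r))}"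
    by (intro CollectI exI[of _ 1] conjI refl exI[of _ 4]) simp_all
  then show ?thesis unfolding assouad_dim_def one_ereal_def by (rule Inf_lower)
qed

section \<open>Bounded distortion\<close>

text \<open>Passes a Hoelder bound from derivatives bounded away from 0 to their logarithms, which
  add up under the chain rule.\<close>

lemma ln_diff_le:
  fixes s t :: real
  assumes "0 < l" "l \<le> s" "l \<le> t"
  shows "\<bar>ln s - ln t\<bar> \<le> \<bar>s - t\<bar> / l"
proof -
  have *: "ln s - ln t \<le> \<bar>s - t\<bar> / l" if "l \<le> s" "l \<le> t" for s t :: real
  proof -
    have "ln s - ln t = ln (s / t)" using that assms by (simp add: ln_div)
    also have "\<dots> \<le> s / t - 1" using that assms by (intro ln_le_minus_one) auto
    also have "\<dots> = (s - t) / t" using that assms by (simp add: field_simps)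
    also have "\<dots> \<le> \<bar>s - t\<bar> / t" using that assms by (intro divide_right_mono) auto
    also have "\<dots> \<le> \<bar>s - t\<bar> / l" using that assms by (intro divide_left_mono) auto
    finally show ?thesis .
  qed
  from *[of s t] *[of t s] assms show ?thesis by (auto simp: abs_minus_commute)
qed

text \<open>The way back from logarithms to derivatives in \<open>wd_hoelder\<close>.\<close>

lemma exp_diff_le:
  fixes s t :: real
  assumes "s \<le> M" "t \<le> M"
  shows "\<bar>exp s - exp t\<bar> \<le> exp M * \<bar>s - t\<bar>"
proof -
  have *: "exp s - exp t \<le> exp M * \<bar>s - t\<bar>" if "s \<le> M" for s t :: real
  proof (cases "t \<le> s")
    case True
    have "exp s - exp t = exp s * (1 - exp (t - s))" by (simp add: algebra_simps exp_diff)
    also have "\<dots> \<le> exp s * (s - t)"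
      using exp_ge_add_one_self[of "t - s"] by (intro mult_left_mono) (linarith, simp)
    also have "\<dots> \<le> exp M * \<bar>s - t\<bar>" using that True by (intro mult_mono) auto
    finally show ?thesis .
  next
    case False
    then have "exp s - exp t \<le> 0" by simp
    also have "0 \<le> exp M * \<bar>s - t\<bar>" by simp
    finally show ?thesis .
  qed
  from *[of s t] *[of t s] assms show ?thesis by (auto simp: abs_minus_commute)
qed

lemma word_map_append: "word_map \<phi> (u @ v) x = word_map \<phi> u (word_map \<phi> v x)"
  by (induction u) auto

(* Derivatives are bounded below only on the compact interval {A..B}, which contains the images of
   all maps: on \<Omega> itself they may tend to 0 at the boundary. *)
locale regular_IFS =
  fixes I :: "nat set" and \<Omega> F :: "real set" and \<phi> :: "nat \<Rightarrow> real \<Rightarrow> real"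
    and A B m \<rho> c \<alpha> y0 y1 :: real
  assumes interval: "{A..B} \<subseteq> \<Omega>"
    and maps_to: "\<And>i x. i \<in> I \<Longrightarrow> x \<in> \<Omega> \<Longrightarrow> \<phi> i x \<in> {A..B}"
    and has_deriv: "\<And>i x. i \<in> I \<Longrightarrow> x \<in> \<Omega> \<Longrightarrow> (\<phi> i has_real_derivative deriv (\<phi> i) x) (at x)"
    and deriv_upper: "\<And>i x. i \<in> I \<Longrightarrow> x \<in> \<Omega> \<Longrightarrow> \<bar>deriv (\<phi> i) x\<bar> \<le> \<rho>"
    and deriv_lower: "\<And>i x. i \<in> I \<Longrightarrow> x \<in> {A..B} \<Longrightarrow> m \<le> \<bar>deriv (\<phi> i) x\<bar>"
    and deriv_hoelder: "\<And>i x y. i \<in> I \<Longrightarrow> x \<in> {A..B} \<Longrightarrow> y \<in> {A..B} \<Longrightarrow>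
          \<bar>deriv (\<phi> i) x - deriv (\<phi> i) y\<bar> \<le> c * \<bar>x - y\<bar> powr \<alpha>"
    and m_pos: "0 < m" and rho_pos: "0 < \<rho>" and rho_less: "\<rho> < 1" and alpha_pos: "0 < \<alpha>"
    and c_nonneg: "0 \<le> c"
    and F_subset: "F \<subseteq> {A..B}" and F_compact: "compact F" and F_eq: "F = (\<Union>i\<in>I. \<phi> i ` F)"
    and y0: "y0 \<in> F" and y1: "y1 \<in> F" and y_neq: "y0 \<noteq> y1"
begin

abbreviation wm :: "nat list \<Rightarrow> real \<Rightarrow> real" where "wm \<equiv> word_map \<phi>"

text \<open>The chain rule product for the derivative of \<open>wm u\<close>, written out so that
  estimates can go by induction along the word; \<open>deriv_wm\<close> identifies the two on
  \<Omega>.\<close>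

fun wd :: "nat list \<Rightarrow> real \<Rightarrow> real" where
  "wd [] x = 1"
| "wd (i # u) x = deriv (\<phi> i) (wm u x) * wd u x"

lemma wd_append: "wd (u @ v) x = wd u (wm v x) * wd v x"
  by (induction u) (auto simp: word_map_append)

lemma wm_Omega: "u \<in> lists I \<Longrightarrow> x \<in> \<Omega> \<Longrightarrow> wm u x \<in> \<Omega>"
  by (induction u) (use maps_to interval in auto)

lemma wm_interval: "u \<in> lists I \<Longrightarrow> x \<in> {A..B} \<Longrightarrow> wm u x \<in> {A..B}"
proof (induction u)
  case (Cons i u)
  then have "i \<in> I" "wm u x \<in> \<Omega>" using interval by auto
  then show ?case using maps_to[of i "wm u x"] by simp
qed auto

lemma wm_F: "u \<in> lists I \<Longrightarrow> x \<in> F \<Longrightarrow> wm u x \<in> F"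
  by (induction u) (use F_eq in auto)

lemma has_deriv_wm:
  "u \<in> lists I \<Longrightarrow> x \<in> \<Omega> \<Longrightarrow> (wm u has_real_derivative wd u x) (at x)"
proof (induction u)
  case Nil
  show ?case by (simp add: id_def)
next
  case (Cons i u)
  have "((\<lambda>x. \<phi> i (wm u x)) has_real_derivative deriv (\<phi> i) (wm u x) * wd u x) (at x)"
    by (rule DERIV_chain2[OF has_deriv]) (use Cons wm_Omega in auto)
  then show ?case by (simp add: o_def)
qed

lemma wd_upper: "u \<in> lists I \<Longrightarrow> x \<in> \<Omega> \<Longrightarrow> \<bar>wd u x\<bar> \<le> \<rho> ^ length u"
proof (induction u)
  case (Cons i u)
  then show ?case
    using deriv_upper[of i "wm u x"] wm_Omega[of u x] rho_pos
    by (auto simp: abs_mult intro!: mult_mono)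
qed auto

lemma wd_le_1: "u \<in> lists I \<Longrightarrow> x \<in> \<Omega> \<Longrightarrow> \<bar>wd u x\<bar> \<le> 1"
  using wd_upper[of u x] power_le_one[of \<rho> "length u"] rho_pos rho_less by linarith

lemma wd_nonzero: "u \<in> lists I \<Longrightarrow> x \<in> {A..B} \<Longrightarrow> wd u x \<noteq> 0"
proof (induction u)
  case (Cons i u)
  then have "deriv (\<phi> i) (wm u x) \<noteq> 0"
    using deriv_lower[of i "wm u x"] wm_interval[of u x] m_pos by auto
  then show ?case using Cons by auto
qed auto

lemma wm_MVT:
  assumes u: "u \<in> lists I" and x: "x \<in> {A..B}" and y: "y \<in> {A..B}"
  obtains z where "z \<in> {A..B}" "wm u y - wm u x = wd u z * (y - x)"
proof -
  have D: "(wm u has_real_derivative wd u z) (at z)" if "z \<in> {A..B}" for z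
    using has_deriv_wm[OF u] interval that by blast
  consider "x = y" | "x < y" | "y < x" by linarith
  then show ?thesis
  proof cases
    case 1 then show ?thesis using that x by auto
  next
    case 2
    then obtain z where "x < z" "z < y" "wm u y - wm u x = (y - x) * wd u z"
      using MVT2[of x y "wm u" "wd u"] D x y by force
    then show ?thesis using that[of z] x y by (auto simp: mult.commute)
  next
    case 3
    then obtain z where "y < z" "z < x" "wm u x - wm u y = (x - y) * wd u z"
      using MVT2[of y x "wm u" "wd u"] D x y by force
    then show ?thesis using that[of z] x y by (auto simp: algebra_simps)
  qed
qed

lemma wm_contract:
  assumes "u \<in> lists I" "x \<in> {A..B}" "y \<in> {A..B}"
  shows "\<bar>wm u x - wm u y\<bar> \<le> \<rho> ^ length u * \<bar>x - y\<bar>"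
proof -
  obtain z where "z \<in> {A..B}" "wm u x - wm u y = wd u z * (x - y)"
    using wm_MVT[OF assms(1,3,2)] .
  then show ?thesis using wd_upper[OF assms(1), of z] interval
    by (auto simp: abs_mult intro!: mult_right_mono)
qed

text \<open>The Hoelder bound makes the derivative continuous, and a continuous function without
  zeros on an interval keeps its sign. This gives each word a well-defined orientation on
  \<open>{A..B}\<close>.\<close>

lemma deriv_sign:
  assumes i: "i \<in> I" and x: "x \<in> {A..B}" and y: "y \<in> {A..B}"
  shows "0 < deriv (\<phi> i) x * deriv (\<phi> i) y"
proof -
  have lim: "continuous_on {A..B} (deriv (\<phi> i))"
    unfolding continuous_on_def
  proof
    fix z assume z: "z \<in> {A..B}"
    have "((\<lambda>t. \<bar>t - z\<bar>) \<longlongrightarrow> \<bar>z - z\<bar>) (at z within {A..B})"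
      by (intro tendsto_intros)
    from tendsto_mult_right_zero[OF tendsto_zero_powrI[OF this[simplified] tendsto_const _ alpha_pos], of c]
    have "((\<lambda>t. c * \<bar>t - z\<bar> powr \<alpha>) \<longlongrightarrow> 0) (at z within {A..B})"
      by simp
    moreover have "\<forall>\<^sub>F t in at z within {A..B}. norm (deriv (\<phi> i) t - deriv (\<phi> i) z) \<le> c * \<bar>t - z\<bar> powr \<alpha>"
      unfolding eventually_at_filter by (rule always_eventually) (simp add: deriv_hoelder[OF i _ z])
    ultimately have "((\<lambda>t. deriv (\<phi> i) t - deriv (\<phi> i) z) \<longlongrightarrow> 0) (at z within {A..B})"
      by (rule Lim_null_comparison[rotated])
    then show "(deriv (\<phi> i) \<longlongrightarrow> deriv (\<phi> i) z) (at z within {A..B})"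
      by (simp add: LIM_zero_iff)
  qed
  have "connected (deriv (\<phi> i) ` {A..B})"
    by (rule connected_continuous_image[OF lim]) simp
  moreover have "0 \<notin> deriv (\<phi> i) ` {A..B}"
    using deriv_lower[OF i] m_pos by fastforce
  ultimately have "\<not> (deriv (\<phi> i) x \<le> 0 \<and> 0 \<le> deriv (\<phi> i) y)"
    "\<not> (deriv (\<phi> i) y \<le> 0 \<and> 0 \<le> deriv (\<phi> i) x)"
    using connectedD_interval[of "deriv (\<phi> i) ` {A..B}"] x y by (meson imageI)+
  then show ?thesis by (auto simp: zero_less_mult_iff)
qed

lemma wd_sign:
  "u \<in> lists I \<Longrightarrow> x \<in> {A..B} \<Longrightarrow> y \<in> {A..B} \<Longrightarrow> 0 < wd u x * wd u y"
proof (induction u)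
  case (Cons i u)
  then have "0 < deriv (\<phi> i) (wm u x) * deriv (\<phi> i) (wm u y)"
    using deriv_sign wm_interval by auto
  moreover have "0 < wd u x * wd u y" using Cons by auto
  ultimately have "0 < (deriv (\<phi> i) (wm u x) * deriv (\<phi> i) (wm u y)) * (wd u x * wd u y)"
    by (rule mult_pos_pos)
  then show ?case by (simp add: mult_ac)
qed auto

text \<open>The logarithm turns the chain rule product into a sum over letters. A letter with k
  letters to its right is evaluated at two points at most \<rho>^k * |x - y| apart, so its term
  decays geometrically in k.\<close>

lemma ln_wd_diff_sum:
  assumes "u \<in> lists I" "x \<in> {A..B}" "y \<in> {A..B}"
  shows "\<bar>ln (abs (wd u x)) - ln (abs (wd u y))\<bar>
    \<le> c / m * (\<Sum>k<length u. (\<rho> powr \<alpha>) ^ k) * \<bar>x - y\<bar> powr \<alpha>"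
  using assms(1)
proof (induction u)
  case (Cons i u)
  then have u: "u \<in> lists I" and i: "i \<in> I" by auto
  let ?x = "wm u x" and ?y = "wm u y" and ?d = "deriv (\<phi> i)"
  have X: "?x \<in> {A..B}" "?y \<in> {A..B}" using wm_interval u assms by auto
  have "\<bar>ln (abs (?d ?x)) - ln (abs (?d ?y))\<bar> \<le> \<bar>\<bar>?d ?x\<bar> - \<bar>?d ?y\<bar>\<bar> / m"
    by (rule ln_diff_le) (use m_pos deriv_lower[OF i] X in auto)
  also have "\<dots> \<le> (c * \<bar>?x - ?y\<bar> powr \<alpha>) / m"
    using deriv_hoelder[OF i X] m_pos by (intro divide_right_mono) auto
  also have "\<dots> \<le> (c * (\<rho> ^ length u * \<bar>x - y\<bar>) powr \<alpha>) / m"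
    using wm_contract[OF u assms(2,3)] m_pos c_nonneg alpha_pos
    by (intro divide_right_mono mult_left_mono powr_mono2) auto
  also have "\<dots> = c / m * (\<rho> powr \<alpha>) ^ length u * \<bar>x - y\<bar> powr \<alpha>"
    using rho_pos by (simp add: powr_mult powr_power powr_realpow[symmetric] powr_powr mult.commute)
  finally have 1: "\<bar>ln (abs (?d ?x)) - ln (abs (?d ?y))\<bar> \<le> c / m * (\<rho> powr \<alpha>) ^ length u * \<bar>x - y\<bar> powr \<alpha>" .
  have nz: "?d ?x \<noteq> 0" "?d ?y \<noteq> 0" "wd u x \<noteq> 0" "wd u y \<noteq> 0"
    using deriv_lower[OF i X(1)] deriv_lower[OF i X(2)] m_pos wd_nonzero[OF u assms(2)]
      wd_nonzero[OF u assms(3)] by auto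
  have "ln (abs (wd (i # u) x)) - ln (abs (wd (i # u) y))
      = (ln (abs (?d ?x)) - ln (abs (?d ?y))) + (ln (abs (wd u x)) - ln (abs (wd u y)))"
    using nz by (simp add: abs_mult ln_mult)
  from this[THEN arg_cong[where f = abs]] have "\<bar>ln (abs (wd (i # u) x)) - ln (abs (wd (i # u) y))\<bar>
      \<le> \<bar>ln (abs (?d ?x)) - ln (abs (?d ?y))\<bar> + \<bar>ln (abs (wd u x)) - ln (abs (wd u y))\<bar>"
    by (simp only: abs_triangle_ineq)
  also have "\<dots> \<le> c / m * (\<rho> powr \<alpha>) ^ length u * \<bar>x - y\<bar> powr \<alpha>
      + c / m * (\<Sum>k<length u. (\<rho> powr \<alpha>) ^ k) * \<bar>x - y\<bar> powr \<alpha>"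
    by (rule add_mono[OF 1 Cons.IH])
  also have "\<dots> = c / m * (\<Sum>k<length (i # u). (\<rho> powr \<alpha>) ^ k) * \<bar>x - y\<bar> powr \<alpha>"
    by (simp add: algebra_simps add_divide_distrib)
  finally show ?case .
qed auto

text \<open>Replaces the partial geometric sum of \<open>ln_wd_diff_sum\<close> by the full series,
  so that the bound is uniform in the word length.\<close>

definition H :: real where "H = c / m / (1 - \<rho> powr \<alpha>)"

lemma H_nonneg: "0 \<le> H" and ln_wd_diff:
  "u \<in> lists I \<Longrightarrow> x \<in> {A..B} \<Longrightarrow> y \<in> {A..B} \<Longrightarrow>
    \<bar>ln (abs (wd u x)) - ln (abs (wd u y))\<bar> \<le> H * \<bar>x - y\<bar> powr \<alpha>"
proof -
  have q: "0 < \<rho> powr \<alpha>" "\<rho> powr \<alpha> < 1"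
    using rho_pos rho_less alpha_pos powr_less_mono2[of \<alpha> \<rho> 1] by auto
  show "0 \<le> H" unfolding H_def using q c_nonneg m_pos by auto
  assume a: "u \<in> lists I" "x \<in> {A..B}" "y \<in> {A..B}"
  have "(\<Sum>k<length u. (\<rho> powr \<alpha>) ^ k) \<le> 1 / (1 - \<rho> powr \<alpha>)"
    using q by (subst sum_gp_strict) (auto intro!: divide_right_mono)
  then have "c / m * (\<Sum>k<length u. (\<rho> powr \<alpha>) ^ k) * \<bar>x - y\<bar> powr \<alpha> \<le> c / m * (1 / (1 - \<rho> powr \<alpha>)) * \<bar>x - y\<bar> powr \<alpha>"
    using c_nonneg m_pos by (intro mult_right_mono mult_left_mono) auto
  with ln_wd_diff_sum[OF a] show "\<bar>ln (abs (wd u x)) - ln (abs (wd u y))\<bar> \<le> H * \<bar>x - y\<bar> powr \<alpha>"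
    unfolding H_def by simp
qed

text \<open>The distortion constant: the logarithmic bound at the largest distance within
  \<open>{A..B}\<close>, exponentiated.\<close>

definition K :: real where "K = exp (H * (B - A) powr \<alpha>)"

lemma K_ge_1: "1 \<le> K"
  unfolding K_def using H_nonneg by simp

lemma bounded_distortion:
  assumes "u \<in> lists I" "x \<in> {A..B}" "y \<in> {A..B}"
  shows "\<bar>wd u x\<bar> \<le> K * \<bar>wd u y\<bar>"
proof -
  have "ln (abs (wd u x)) - ln (abs (wd u y)) \<le> H * \<bar>x - y\<bar> powr \<alpha>"
    using ln_wd_diff[OF assms] by linarith
  also have "\<dots> \<le> H * (B - A) powr \<alpha>"
    using H_nonneg alpha_pos assms by (intro mult_left_mono powr_mono2) auto
  finally have "exp (ln (abs (wd u x))) \<le> exp (H * (B - A) powr \<alpha> + ln (abs (wd u y)))"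
    by simp
  then show ?thesis using wd_nonzero[OF assms(1)] assms by (simp add: exp_add K_def)
qed

text \<open>The derivatives of long words inherit the Hoelder bound with a constant proportional to
  their own size. Equal signs reduce the claim to absolute values; there the logarithmic bound is
  exponentiated, bounded distortion supplying the common upper bound.\<close>

lemma wd_hoelder:
  assumes u: "u \<in> lists I" and x: "x \<in> {A..B}" and y: "y \<in> {A..B}" and z: "z \<in> {A..B}"
  shows "\<bar>wd u x - wd u y\<bar> \<le> K * H * \<bar>wd u z\<bar> * \<bar>x - y\<bar> powr \<alpha>"
proof -
  have nz: "wd u x \<noteq> 0" "wd u y \<noteq> 0" "wd u z \<noteq> 0" using wd_nonzero[OF u] x y z by auto
  have M: "ln (abs (wd u t)) \<le> ln (K * \<bar>wd u z\<bar>)" if "t \<in> {A..B}" for t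
    using bounded_distortion[OF u that z] wd_nonzero[OF u that] K_ge_1 nz
    by (subst ln_le_cancel_iff) auto
  have "\<bar>wd u x - wd u y\<bar> = \<bar>\<bar>wd u x\<bar> - \<bar>wd u y\<bar>\<bar>"
    using wd_sign[OF u x y] by (auto simp: zero_less_mult_iff)
  also have "\<dots> = \<bar>exp (ln (abs (wd u x))) - exp (ln (abs (wd u y)))\<bar>" using nz by simp
  also have "\<dots> \<le> exp (ln (K * \<bar>wd u z\<bar>)) * \<bar>ln (abs (wd u x)) - ln (abs (wd u y))\<bar>"
    by (rule exp_diff_le[OF M[OF x] M[OF y]])
  also have "\<dots> = K * \<bar>wd u z\<bar> * \<bar>ln (abs (wd u x)) - ln (abs (wd u y))\<bar>"
    using K_ge_1 nz by simp
  also have "\<dots> \<le> K * \<bar>wd u z\<bar> * (H * \<bar>x - y\<bar> powr \<alpha>)"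
    using ln_wd_diff[OF u x y] K_ge_1 by (intro mult_left_mono) auto
  finally show ?thesis by (simp add: mult_ac)
qed

section \<open>Contraction ratios of words and cylinders of prescribed size\<close>

lemma F_interval: "x \<in> F \<Longrightarrow> x \<in> {A..B}"
  using F_subset by blast

lemma y_interval: "y0 \<in> {A..B}" "y1 \<in> {A..B}"
  using y0 y1 F_interval by blast+

text \<open>The contraction ratio of a word, up to the factor \<open>K\<close>. A reference point in
  F is used instead of the supremum over \<Omega> because distortion is controlled only on
  \<open>{A..B}\<close>; \<open>deriv_norm_le\<close> makes the link.\<close>

definition lam :: "nat list \<Rightarrow> real" where "lam u = \<bar>wd u y0\<bar>"

definition d :: real where "d = \<bar>y0 - y1\<bar>"

lemma d_pos: "0 < d"
  using y_neq by (simp add: d_def)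

lemma d_le: "d \<le> B - A"
  using y_interval by (auto simp: d_def)

lemma lam_pos: "u \<in> lists I \<Longrightarrow> 0 < lam u"
  unfolding lam_def using wd_nonzero y_interval by auto

lemma wd_le_lam: "u \<in> lists I \<Longrightarrow> x \<in> {A..B} \<Longrightarrow> \<bar>wd u x\<bar> \<le> K * lam u"
  unfolding lam_def using bounded_distortion y_interval by blast

lemma lam_le_wd: "u \<in> lists I \<Longrightarrow> x \<in> {A..B} \<Longrightarrow> lam u \<le> K * \<bar>wd u x\<bar>"
  unfolding lam_def using bounded_distortion y_interval by blast

lemma lam_append: "lam (u @ v) = \<bar>wd u (wm v y0)\<bar> * lam v"
  by (simp add: lam_def wd_append abs_mult)

lemma lam_append_upper:
  assumes "u \<in> lists I" "v \<in> lists I"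
  shows "lam (u @ v) \<le> K * lam u * lam v"
  unfolding lam_append
  using wd_le_lam[OF assms(1), of "wm v y0"] wm_interval[OF assms(2)] y_interval lam_pos[OF assms(2)]
  by (intro mult_right_mono) auto

lemma lam_append_lower:
  assumes "u \<in> lists I" "v \<in> lists I"
  shows "lam u * lam v \<le> K * lam (u @ v)"
proof -
  have "lam u * lam v \<le> (K * \<bar>wd u (wm v y0)\<bar>) * lam v"
    using lam_le_wd[OF assms(1), of "wm v y0"] wm_interval[OF assms(2)] y_interval lam_pos[OF assms(2)]
    by (intro mult_right_mono) auto
  then show ?thesis by (simp add: lam_append)
qed

lemma lam_letter: "i \<in> I \<Longrightarrow> m \<le> lam [i]" "i \<in> I \<Longrightarrow> lam [i] \<le> 1"
  using deriv_lower[of i y0] deriv_upper[of i y0] y_interval interval rho_less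
  by (fastforce simp: lam_def)+

lemma wm_dist_upper:
  assumes "u \<in> lists I" "x \<in> {A..B}" "y \<in> {A..B}"
  shows "\<bar>wm u x - wm u y\<bar> \<le> K * lam u * \<bar>x - y\<bar>"
proof -
  obtain z where "z \<in> {A..B}" "wm u x - wm u y = wd u z * (x - y)"
    using wm_MVT[OF assms(1,3,2)] .
  then show ?thesis using wd_le_lam[OF assms(1), of z]
    by (auto simp: abs_mult intro!: mult_right_mono)
qed

lemma wm_dist_lower:
  assumes "u \<in> lists I" "x \<in> {A..B}" "y \<in> {A..B}"
  shows "lam u * \<bar>x - y\<bar> \<le> K * \<bar>wm u x - wm u y\<bar>"
proof -
  obtain z where "z \<in> {A..B}" "wm u x - wm u y = wd u z * (x - y)"
    using wm_MVT[OF assms(1,3,2)] .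
  then show ?thesis using mult_right_mono[OF lam_le_wd[OF assms(1), of z], of "\<bar>x - y\<bar>"]
    by (auto simp: abs_mult mult.assoc)
qed

lemma coding:
  assumes "x \<in> F"
  shows "\<exists>u\<in>lists I. length u = n \<and> x \<in> wm u ` F"
  using assms
proof (induction n arbitrary: x)
  case 0
  then show ?case by (intro bexI[of _ "[]"]) auto
next
  case (Suc n)
  obtain i y where i: "i \<in> I" "y \<in> F" "x = \<phi> i y" using Suc.prems F_eq by blast
  obtain u where u: "u \<in> lists I" "length u = n" "y \<in> wm u ` F" using Suc.IH[OF i(2)] by blast
  then show ?case using i by (intro bexI[of _ "i # u"]) auto
qed

text \<open>Take a shortest word with x in its cylinder and ratio at most D. Dropping its last
  letter keeps x in the cylinder, so by minimality the ratio then exceeds D; restoring the letter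
  costs at most a factor m / K.\<close>

lemma cylinder:
  assumes x: "x \<in> F" and D: "0 < D" "D \<le> 1"
  obtains u z where "u \<in> lists I" "z \<in> F" "x = wm u z" "m / K * D \<le> lam u" "lam u \<le> D"
proof -
  define P where "P = (\<lambda>n. \<exists>u\<in>lists I. length u = n \<and> x \<in> wm u ` F \<and> lam u \<le> D)"
  obtain n where n: "\<rho> ^ n < D" using real_arch_pow_inv[OF D(1) rho_less] by blast
  obtain u where u: "u \<in> lists I" "length u = n" "x \<in> wm u ` F" using coding[OF x] by blast
  have "lam u \<le> \<rho> ^ length u" unfolding lam_def
    using wd_upper[OF u(1), of y0] y_interval interval by blast
  then have "P n" unfolding P_def using u n by force
  define l where "l = (LEAST n. P n)"
  have "P l" unfolding l_def by (rule LeastI[of P, OF \<open>P n\<close>])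
  then obtain u z where u: "u \<in> lists I" "length u = l" "z \<in> F" "x = wm u z" "lam u \<le> D"
    unfolding P_def by blast
  have mK: "m / K \<le> m" using K_ge_1 m_pos by (simp add: field_simps)
  have "m / K * D \<le> lam u"
  proof (cases u rule: rev_cases)
    case Nil
    obtain i where "i \<in> I" using y0 F_eq by blast
    then have "m \<le> 1" using lam_letter[of i] by linarith
    then have "m / K * D \<le> 1 * 1" using mK m_pos D K_ge_1 by (intro mult_mono) auto
    then show ?thesis using Nil by (simp add: lam_def)
  next
    case (snoc v i)
    then have v: "v \<in> lists I" "i \<in> I" using u by auto
    have "\<phi> i z \<in> F" using F_eq v u by blast
    then have "x \<in> wm v ` F" using u(4) snoc by (auto simp: word_map_append)
    moreover have "\<not> P (length v)" using not_less_Least[of "length v" P] u(2) snoc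
      unfolding l_def by simp
    ultimately have "D < lam v" using v unfolding P_def by force
    then have "D * m \<le> lam v * lam [i]" using lam_letter[OF v(2)] D m_pos by (intro mult_mono) auto
    also have "\<dots> \<le> K * lam u" using lam_append_lower[of v "[i]"] v snoc by simp
    finally show ?thesis using K_ge_1 by (simp add: field_simps)
  qed
  with u that show ?thesis by blast
qed

text \<open>The distance between the images of y0 and y1 measures the contraction, and closeness at
  these two points makes the two distances comparable.\<close>

lemma close_lam_upper:
  assumes u: "u \<in> lists I" and v: "v \<in> lists I" and e: "\<epsilon> \<le> 1"
    and close: "\<And>x. x \<in> F \<Longrightarrow> \<bar>wm v x - wm u x\<bar> \<le> \<epsilon> * lam u"
  shows "lam v \<le> K * (K + 2 / d) * lam u"
proof -
  have e1: "\<epsilon> * lam u \<le> lam u" using e lam_pos[OF u] by simp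
  have "lam v * d \<le> K * \<bar>wm v y0 - wm v y1\<bar>" unfolding d_def by (rule wm_dist_lower[OF v y_interval])
  also have "\<dots> \<le> K * (K * lam u * d + 2 * lam u)"
    using wm_dist_upper[OF u y_interval] close[OF y0] close[OF y1] e1 K_ge_1
    unfolding d_def[symmetric] by (intro mult_left_mono) (linarith, simp)
  finally show ?thesis using d_pos by (simp add: field_simps)
qed

text \<open>As in \<open>close_lam_upper\<close> with the roles exchanged, but now the error is
  itself proportional to \<open>lam u\<close>; the bound on \<epsilon> makes it at most half of the
  left-hand side, which absorbs it.\<close>

lemma close_lam_lower:
  assumes u: "u \<in> lists I" and v: "v \<in> lists I" and e: "\<epsilon> \<le> d / (4 * K)"
    and close: "\<And>x. x \<in> F \<Longrightarrow> \<bar>wm v x - wm u x\<bar> \<le> \<epsilon> * lam u"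
  shows "lam u \<le> 2 * K\<^sup>2 * lam v"
proof -
  have K: "0 < K" using K_ge_1 by simp
  have e1: "\<epsilon> * lam u \<le> d / (4 * K) * lam u" using e lam_pos[OF u] by (intro mult_right_mono) auto
  have "lam u * d \<le> K * \<bar>wm u y0 - wm u y1\<bar>" unfolding d_def by (rule wm_dist_lower[OF u y_interval])
  also have "\<dots> \<le> K * (K * lam v * d + 2 * (d / (4 * K) * lam u))"
    using wm_dist_upper[OF v y_interval] close[OF y0] close[OF y1] e1 K_ge_1
    unfolding d_def[symmetric] by (intro mult_left_mono) (linarith, simp)
  also have "\<dots> = K\<^sup>2 * lam v * d + lam u * d / 2" using K by (simp add: field_simps power2_eq_square)
  finally have "d * lam u \<le> d * (2 * K\<^sup>2 * lam v)" by (simp add: algebra_simps)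
  then show ?thesis using d_pos by simp
qed

section \<open>Nearly coinciding words\<close>

text \<open>Heuristically, the inverse of \<open>wm u\<close> followed after \<open>wm v\<close> is
  arbitrarily close to the identity on F without being equal to it. This is the failure of the
  criterion with \<open>lam u\<close> in place of the derivative norm.\<close>

definition near_identity :: bool where
  "near_identity \<longleftrightarrow> (\<forall>\<epsilon>>0. \<exists>u\<in>lists I. \<exists>v\<in>lists I.
     (\<exists>x\<in>F. wm u x \<noteq> wm v x) \<and> (\<forall>x\<in>F. \<bar>wm v x - wm u x\<bar> \<le> \<epsilon> * lam u))"

lemma continuous_wm: "u \<in> lists I \<Longrightarrow> continuous_on F (wm u)"
  using has_deriv_wm F_subset interval
  by (meson DERIV_isCont continuous_at_imp_continuous_on subsetD)

text \<open>Compactness of F provides a point of maximal difference; if the difference is negative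
  there, u and v are exchanged.\<close>

lemma near_identity_pos:
  assumes near_identity and e: "0 < \<epsilon>"
  obtains u v x0 where "u \<in> lists I" "v \<in> lists I" "x0 \<in> F" "0 < wm v x0 - wm u x0"
    "wm v x0 - wm u x0 \<le> \<epsilon> * lam u" "\<forall>x\<in>F. \<bar>wm v x - wm u x\<bar> \<le> wm v x0 - wm u x0"
proof -
  have K: "0 < K" using K_ge_1 by simp
  \<comment> \<open>The second entry keeps the bound relative to \<open>lam v\<close> after an
    exchange, and the third is the threshold of \<open>close_lam_lower\<close>.\<close>
  define \<delta> where "\<delta> = min \<epsilon> (min (\<epsilon> / (2 * K\<^sup>2)) (d / (4 * K)))"
  have "0 < \<delta>" using e K d_pos by (simp add: \<delta>_def)
  then obtain u v y where uv: "u \<in> lists I" "v \<in> lists I" "y \<in> F" "wm u y \<noteq> wm v y"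
    and close: "\<And>x. x \<in> F \<Longrightarrow> \<bar>wm v x - wm u x\<bar> \<le> \<delta> * lam u"
    using assms(1) unfolding near_identity_def by blast
  have "continuous_on F (\<lambda>x. \<bar>wm v x - wm u x\<bar>)"
    by (intro continuous_intros continuous_wm uv)
  then obtain x0 where x0: "x0 \<in> F" "\<And>x. x \<in> F \<Longrightarrow> \<bar>wm v x - wm u x\<bar> \<le> \<bar>wm v x0 - wm u x0\<bar>"
    using continuous_attains_sup[OF F_compact, of "\<lambda>x. \<bar>wm v x - wm u x\<bar>"] y0 by blast
  have nz: "0 < \<bar>wm v x0 - wm u x0\<bar>" using x0(2)[OF uv(3)] uv(4) by linarith
  have lu: "lam u \<le> 2 * K\<^sup>2 * lam v"
    by (rule close_lam_lower[OF uv(1,2) _ close]) (simp add: \<delta>_def)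
  have "\<bar>wm v x0 - wm u x0\<bar> \<le> \<delta> * lam u" by (rule close[OF x0(1)])
  also have "\<dots> \<le> \<epsilon> / (2 * K\<^sup>2) * (2 * K\<^sup>2 * lam v)"
    using lu lam_pos[OF uv(1)] e by (intro mult_mono) (auto simp: \<delta>_def)
  finally have v: "\<bar>wm v x0 - wm u x0\<bar> \<le> \<epsilon> * lam v" using K by simp
  have "\<delta> * lam u \<le> \<epsilon> * lam u" using lam_pos[OF uv(1)] by (intro mult_right_mono) (auto simp: \<delta>_def)
  then have u: "\<bar>wm v x0 - wm u x0\<bar> \<le> \<epsilon> * lam u" using close[OF x0(1)] by linarith
  show ?thesis
  proof (cases "0 < wm v x0 - wm u x0")
    case True
    then show ?thesis using that[OF uv(1,2) x0(1)] u x0(2) by auto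
  next
    case False
    then have eq: "\<bar>wm v x0 - wm u x0\<bar> = wm u x0 - wm v x0" "0 < wm u x0 - wm v x0" using nz by auto
    show ?thesis using that[OF uv(2,1) x0(1) eq(2)] v x0(2) unfolding eq(1)
      by (metis abs_minus_commute)
  qed
qed

lemma wm_diff_MVT:
  assumes u: "u \<in> lists I" and v: "v \<in> lists I" and x: "x \<in> {A..B}" and y: "y \<in> {A..B}"
  obtains z where "z \<in> {A..B}" "\<bar>z - x\<bar> \<le> \<bar>y - x\<bar>"
    "(wm v y - wm u y) - (wm v x - wm u x) = (wd v z - wd u z) * (y - x)"
proof -
  have D: "((\<lambda>z. wm v z - wm u z) has_real_derivative wd v z - wd u z) (at z)" if "z \<in> {A..B}" for z
    using has_deriv_wm u v interval that by (intro DERIV_diff) blast+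
  consider "x = y" | "x < y" | "y < x" by linarith
  then show ?thesis
  proof cases
    case 1 then show ?thesis using that x by auto
  next
    case 2
    then obtain z where "x < z" "z < y" "(wm v y - wm u y) - (wm v x - wm u x) = (y - x) * (wd v z - wd u z)"
      using MVT2[of x y "\<lambda>z. wm v z - wm u z" "\<lambda>z. wd v z - wd u z"] D x y by force
    then show ?thesis using that[of z] x y by (auto simp: mult.commute)
  next
    case 3
    then obtain z where "y < z" "z < x" "(wm v x - wm u x) - (wm v y - wm u y) = (x - y) * (wd v z - wd u z)"
      using MVT2[of y x "\<lambda>z. wm v z - wm u z" "\<lambda>z. wd v z - wd u z"] D x y by force
    then show ?thesis using that[of z] x y by (auto simp: algebra_simps)
  qed
qed

lemma wd_diff_hoelder:
  assumes u: "u \<in> lists I" and v: "v \<in> lists I" and lv: "lam v \<le> M * lam u"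
    and x: "x \<in> {A..B}" and y: "y \<in> {A..B}"
  shows "\<bar>(wd v x - wd u x) - (wd v y - wd u y)\<bar> \<le> K * H * (1 + M) * lam u * \<bar>x - y\<bar> powr \<alpha>"
proof -
  have KH: "0 \<le> K * H" using K_ge_1 H_nonneg by simp
  have "\<bar>wd u x - wd u y\<bar> \<le> K * H * lam u * \<bar>x - y\<bar> powr \<alpha>"
    unfolding lam_def by (rule wd_hoelder[OF u x y y_interval(1)])
  moreover have "\<bar>wd v x - wd v y\<bar> \<le> K * H * lam v * \<bar>x - y\<bar> powr \<alpha>"
    unfolding lam_def by (rule wd_hoelder[OF v x y y_interval(1)])
  moreover have "K * H * lam v * \<bar>x - y\<bar> powr \<alpha> \<le> K * H * (M * lam u) * \<bar>x - y\<bar> powr \<alpha>"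
    using lv KH by (intro mult_right_mono mult_left_mono) auto
  ultimately have "\<bar>(wd v x - wd u x) - (wd v y - wd u y)\<bar>
      \<le> K * H * lam u * \<bar>x - y\<bar> powr \<alpha> + K * H * (M * lam u) * \<bar>x - y\<bar> powr \<alpha>"
    by linarith
  then show ?thesis by (simp add: algebra_simps)
qed

text \<open>Write h for the difference \<open>wm v - wm u\<close>, with maximum \<delta> *
  \<open>lam u\<close> at x0. Interpolation bounds its derivative near x0, so that h stays between
  1/2 and 3/2 of its maximum on a cylinder of size E = \<delta>/t. Appending the word of this
  cylinder to u and v multiplies the contraction by about E and leaves the size of the difference,
  so their ratio becomes \<delta>/E = t.\<close>

lemma tuned_pair:
  assumes near_identity and t: "0 < t" "t \<le> 1"
  obtains i j where "i \<in> lists I" "j \<in> lists I"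
    "\<forall>y\<in>F. 1 / (2 * K) * t * lam i \<le> wm j y - wm i y"
    "\<forall>y\<in>F. wm j y - wm i y \<le> 3 * K\<^sup>2 / (2 * m) * t * lam i"
proof -
  have K: "0 < K" "1 \<le> K" using K_ge_1 by auto
  define L where "L = B - A"
  have L: "0 < L" using d_pos d_le by (simp add: L_def)
  define M where "M = K * (K + 2 / d)"
  define C where "C = K * H * (1 + M)"
  have M: "0 \<le> M" unfolding M_def using K d_pos by simp
  have C: "0 \<le> C" unfolding C_def using K M H_nonneg by simp
  define \<kappa> where "\<kappa> = m / K"
  have \<kappa>: "0 < \<kappa>" unfolding \<kappa>_def using m_pos K by simp
  \<comment> \<open>Up to the factor \<eta> * \<delta> * \<open>lam u\<close>, \<open>Q\<close> is
    the variation of h on the small cylinder: \<open>K * L\<close> for the displacement, then the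
    mean slope term and the Hoelder term. The 3 comes from the distances to x0, at most K * L * D
    for \<zeta> and 2 * K * L * D for \<xi>.\<close>
  define Q where "Q = K * L * (2 * K / (\<kappa> * d) + C * (3 * K * L) powr \<alpha>)"
  have Q: "0 \<le> Q" unfolding Q_def using K L \<kappa> d_pos C by (intro mult_nonneg_nonneg add_nonneg_nonneg) auto
  define \<eta> where "\<eta> = 1 / (2 * Q + 1)"
  have \<eta>: "0 < \<eta>" "\<eta> \<le> 1" "\<eta> * Q \<le> 1 / 2" using Q by (auto simp: \<eta>_def field_simps)
  \<comment> \<open>The exponent is the one for which \<delta> \<le> \<epsilon> gives D^\<alpha>
    \<le> t * \<eta>, with D as defined below.\<close>
  define \<epsilon> where "\<epsilon> = (t * \<eta>) powr ((1 + \<alpha>) / \<alpha>)"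
  have t\<eta>: "0 < t * \<eta>" "t * \<eta> \<le> 1" using t \<eta> mult_le_one[of t \<eta>] by auto
  have \<epsilon>: "0 < \<epsilon>" "\<epsilon> \<le> 1" unfolding \<epsilon>_def
    using t\<eta> alpha_pos powr_mono2[of "(1 + \<alpha>) / \<alpha>" "t * \<eta>" 1] by auto
  obtain u v x0 where u: "u \<in> lists I" and v: "v \<in> lists I" and x0: "x0 \<in> F"
    and pos: "0 < wm v x0 - wm u x0" and small: "wm v x0 - wm u x0 \<le> \<epsilon> * lam u"
    and maximal: "\<forall>x\<in>F. \<bar>wm v x - wm u x\<bar> \<le> wm v x0 - wm u x0"
    using near_identity_pos[OF assms(1) \<epsilon>(1)] .
  define h where "h = (\<lambda>x. wm v x - wm u x)"
  define h' where "h' = (\<lambda>x. wd v x - wd u x)"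
  have lu: "0 < lam u" by (rule lam_pos[OF u])
  have close: "\<bar>wm v x - wm u x\<bar> \<le> \<epsilon> * lam u" if "x \<in> F" for x
    using maximal[rule_format, OF that] small by linarith
  have lv: "lam v \<le> M * lam u" unfolding M_def by (rule close_lam_upper[OF u v \<epsilon>(2) close])
  define \<delta> where "\<delta> = h x0 / lam u"
  have h0: "h x0 = \<delta> * lam u" using lu by (simp add: \<delta>_def)
  have \<delta>: "0 < \<delta>" "\<delta> \<le> \<epsilon>" unfolding \<delta>_def h_def using pos lu small by (auto simp: field_simps)
  have hmax: "\<bar>h x\<bar> \<le> \<delta> * lam u" if "x \<in> F" for x
    using maximal[rule_format, OF that] h0 by (simp add: h_def)
  \<comment> \<open>The scale at which the slope term \<delta>/D and the Hoelder term D^\<alpha>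
    coincide.\<close>
  define D where "D = \<delta> powr (1 / (1 + \<alpha>))"
  have D: "0 < D" "D \<le> 1" unfolding D_def using \<delta> \<epsilon> alpha_pos powr_mono2[of "1 / (1 + \<alpha>)" \<delta> 1] by auto
  have D\<alpha>: "D * D powr \<alpha> = \<delta>"
  proof -
    have "D * D powr \<alpha> = D powr (1 + \<alpha>)" using D by (simp add: powr_add)
    then show ?thesis unfolding D_def using \<delta> alpha_pos by (simp add: powr_powr)
  qed
  have "D powr \<alpha> = \<delta> powr (\<alpha> / (1 + \<alpha>))" unfolding D_def by (simp add: powr_powr)
  also have "\<dots> \<le> \<epsilon> powr (\<alpha> / (1 + \<alpha>))" using \<delta> alpha_pos by (intro powr_mono2) auto
  also have "\<dots> = t * \<eta>" unfolding \<epsilon>_def using alpha_pos t\<eta> by (simp add: powr_powr)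
  finally have "D * D powr \<alpha> \<le> D * (t * \<eta>)" using D by (intro mult_left_mono) auto
  then have small_scale: "\<delta> / t \<le> \<eta> * D" unfolding D\<alpha> using t by (simp add: field_simps)
  define E where "E = \<delta> / t"
  have ED: "E \<le> D" using small_scale \<eta> D mult_right_mono[of \<eta> 1 D] unfolding E_def by linarith
  have E: "0 < E" "E \<le> 1" using divide_pos_pos[OF \<delta>(1) t(1)] ED D unfolding E_def by linarith+
  have X0: "x0 \<in> {A..B}" by (rule F_interval[OF x0])
  have near: "\<bar>wm w y - wm w z\<bar> \<le> K * L * s"
    if "w \<in> lists I" "y \<in> {A..B}" "z \<in> {A..B}" "lam w \<le> s" for w y z s
  proof -
    have "\<bar>wm w y - wm w z\<bar> \<le> K * lam w * \<bar>y - z\<bar>" using wm_dist_upper that by blast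
    also have "\<dots> \<le> K * s * L" using that K lam_pos[of w] unfolding L_def
      by (intro mult_mono) auto
    finally show ?thesis by (simp add: mult_ac)
  qed

  \<comment> \<open>The bound on h holds on F only, so the mean slope is taken between two points of
    F. The cylinder provides p and q near x0 with a distance bounded below by a multiple of
    D.\<close>
  obtain w z where w: "w \<in> lists I" and z: "z \<in> F" "x0 = wm w z" and lw: "\<kappa> * D \<le> lam w" "lam w \<le> D"
    using cylinder[OF x0 D] unfolding \<kappa>_def .
  define p q where "p = wm w y0" and "q = wm w y1"
  have pq: "p \<in> F" "q \<in> F" "p \<in> {A..B}" "q \<in> {A..B}"
    unfolding p_def q_def using wm_F[OF w] y0 y1 F_interval by blast+
  obtain \<xi> where \<xi>: "\<xi> \<in> {A..B}" "\<bar>\<xi> - p\<bar> \<le> \<bar>q - p\<bar>" "h q - h p = h' \<xi> * (q - p)"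
    using wm_diff_MVT[OF u v pq(3,4)] unfolding h_def h'_def .
  have "\<kappa> * D * d \<le> lam w * d" using lw d_pos by (intro mult_right_mono) auto
  also have "\<dots> \<le> K * \<bar>q - p\<bar>" using wm_dist_lower[OF w y_interval]
    by (simp add: p_def q_def d_def abs_minus_commute)
  finally have qp: "\<kappa> * D * d \<le> K * \<bar>q - p\<bar>" .
  have "\<bar>h' \<xi>\<bar> * (\<kappa> * D * d) \<le> \<bar>h' \<xi>\<bar> * (K * \<bar>q - p\<bar>)" using qp by (intro mult_left_mono) auto
  also have "\<dots> = K * \<bar>h q - h p\<bar>" using \<xi>(3) by (simp add: abs_mult)
  also have "\<dots> \<le> K * (2 * \<delta> * lam u)"
    using hmax[OF pq(1)] hmax[OF pq(2)] K by (intro mult_left_mono) (linarith, simp)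
  finally have h'\<xi>: "\<bar>h' \<xi>\<bar> \<le> lam u * (2 * K * \<delta> / (\<kappa> * D * d))"
    using \<kappa> D d_pos by (simp add: field_simps)
  have "\<bar>p - x0\<bar> \<le> K * L * D" "\<bar>q - p\<bar> \<le> K * L * D"
    unfolding p_def q_def z(2) using near[OF w _ _ lw(2)] y_interval F_interval z by blast+
  then have \<xi>0: "\<bar>\<xi> - x0\<bar> \<le> 2 * K * L * D" using \<xi>(2) by linarith

  \<comment> \<open>The second cylinder, of size E \<le> \<eta> * D, supplies the word to
    append.\<close>
  obtain w' z' where w': "w' \<in> lists I" and z': "z' \<in> F" "x0 = wm w' z'"
    and lw': "\<kappa> * E \<le> lam w'" "lam w' \<le> E"
    using cylinder[OF x0 E] unfolding \<kappa>_def .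
  have h_near: "\<bar>h (wm w' y) - h x0\<bar> \<le> \<delta> * lam u / 2" if y: "y \<in> F" for y
  proof -
    have Y: "wm w' y \<in> {A..B}" using wm_interval[OF w'] F_interval y by blast
    obtain \<zeta> where \<zeta>: "\<zeta> \<in> {A..B}" "\<bar>\<zeta> - x0\<bar> \<le> \<bar>wm w' y - x0\<bar>"
      "h (wm w' y) - h x0 = h' \<zeta> * (wm w' y - x0)"
      using wm_diff_MVT[OF u v X0 Y] unfolding h_def h'_def .
    have yx: "\<bar>wm w' y - x0\<bar> \<le> K * L * E"
      unfolding z'(2) using near[OF w' _ _ lw'(2)] y z' F_interval by blast
    define R where "R = 2 * K * \<delta> / (\<kappa> * D * d) + C * (3 * K * L) powr \<alpha> * D powr \<alpha>"
    have DR: "K * L * (D * R) = Q * \<delta>"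
      unfolding R_def Q_def distrib_left using D\<alpha> D \<kappa> d_pos by (simp add: field_simps)
    have "K * L * E \<le> K * L * D" using ED K L by (intro mult_left_mono) auto
    then have "\<bar>\<zeta> - \<xi>\<bar> \<le> 3 * K * L * D" using \<zeta>(2) yx \<xi>0 by linarith
    then have "\<bar>\<zeta> - \<xi>\<bar> powr \<alpha> \<le> (3 * K * L * D) powr \<alpha>"
      using alpha_pos by (intro powr_mono2) auto
    also have "\<dots> = (3 * K * L) powr \<alpha> * D powr \<alpha>" using K L D by (intro powr_mult)
    finally have dist: "\<bar>\<zeta> - \<xi>\<bar> powr \<alpha> \<le> (3 * K * L) powr \<alpha> * D powr \<alpha>" .
    have "\<bar>h' \<zeta> - h' \<xi>\<bar> \<le> C * lam u * \<bar>\<zeta> - \<xi>\<bar> powr \<alpha>"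
      unfolding h'_def C_def by (rule wd_diff_hoelder[OF u v lv \<zeta>(1) \<xi>(1)])
    also have "\<dots> \<le> C * lam u * ((3 * K * L) powr \<alpha> * D powr \<alpha>)"
      using dist C lu by (intro mult_left_mono) auto
    also have "\<dots> = lam u * (C * (3 * K * L) powr \<alpha> * D powr \<alpha>)" by (simp add: mult_ac)
    finally have "\<bar>h' \<zeta>\<bar> \<le> lam u * R" using h'\<xi> unfolding R_def distrib_left by linarith
    moreover have "K * L * E \<le> K * L * (\<eta> * D)" using small_scale K L unfolding E_def
      by (intro mult_left_mono) auto
    ultimately have "\<bar>h' \<zeta>\<bar> * \<bar>wm w' y - x0\<bar> \<le> (lam u * R) * (K * L * (\<eta> * D))"
      using yx by (intro mult_mono) auto
    also have "\<dots> = lam u * \<eta> * (K * L * (D * R))" by (simp add: mult_ac)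
    also have "\<dots> = (\<eta> * Q) * (\<delta> * lam u)" unfolding DR by (simp add: mult_ac)
    also have "\<dots> \<le> 1 / 2 * (\<delta> * lam u)" using \<eta>(3) \<delta> lu by (intro mult_right_mono) auto
    finally show ?thesis unfolding \<zeta>(3) by (simp add: abs_mult)
  qed
  have uw: "u @ w' \<in> lists I" "v @ w' \<in> lists I" using u v w' by auto
  have tE: "\<delta> = t * E" using t by (simp add: E_def)
  \<comment> \<open>The ratio of \<open>u @ w'\<close> is comparable to E * \<open>lam u\<close>,
    and \<delta> = t * E, so multiples of \<delta> * \<open>lam u\<close> become multiples of t
    times that ratio.\<close>
  have "lam (u @ w') \<le> K * lam u * lam w'" by (rule lam_append_upper[OF u w'])
  also have "\<dots> \<le> K * lam u * E" using lw' K lu by (intro mult_left_mono) auto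
  finally have "1 / (2 * K) * t * lam (u @ w') \<le> 1 / (2 * K) * t * (K * lam u * E)"
    using K t by (intro mult_left_mono) auto
  also have "\<dots> = \<delta> * lam u / 2" unfolding tE using K by simp
  finally have lo: "1 / (2 * K) * t * lam (u @ w') \<le> \<delta> * lam u / 2" .
  have "\<kappa> * E * lam u \<le> lam w' * lam u" using lw' lu by (intro mult_right_mono) auto
  also have "\<dots> \<le> K * lam (u @ w')" using lam_append_lower[OF u w'] by (simp add: mult.commute)
  finally have "3 * K / (2 * m) * t * (\<kappa> * E * lam u) \<le> 3 * K / (2 * m) * t * (K * lam (u @ w'))"
    using K t m_pos by (intro mult_left_mono) auto
  moreover have "3 * K / (2 * m) * t * (\<kappa> * E * lam u) = 3 / 2 * (\<delta> * lam u)"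
    unfolding tE \<kappa>_def using K m_pos by simp
  moreover have "3 * K / (2 * m) * t * (K * lam (u @ w')) = 3 * K\<^sup>2 / (2 * m) * t * lam (u @ w')"
    by (simp add: power2_eq_square)
  ultimately have hi: "3 / 2 * (\<delta> * lam u) \<le> 3 * K\<^sup>2 / (2 * m) * t * lam (u @ w')" by linarith
  have "\<delta> * lam u / 2 \<le> wm (v @ w') y - wm (u @ w') y \<and>
      wm (v @ w') y - wm (u @ w') y \<le> 3 / 2 * (\<delta> * lam u)" if "y \<in> F" for y
  proof -
    have "wm (v @ w') y - wm (u @ w') y = h (wm w' y)" by (simp add: h_def word_map_append)
    then show ?thesis using h_near[OF that] unfolding h0 by linarith
  qed
  then show ?thesis using that[OF uw] lo hi by (meson order_trans)
qed

section \<open>Orientation of words\<close>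

lemma wd_pos_iff: "u \<in> lists I \<Longrightarrow> x \<in> {A..B} \<Longrightarrow> 0 < wd u x \<longleftrightarrow> 0 < wd u y0"
  using wd_sign[of u x y0] y_interval by (auto simp: zero_less_mult_iff)

lemma wd_neg_letter:
  "u \<in> lists I \<Longrightarrow> wd u y0 < 0 \<Longrightarrow> \<exists>r\<in>I. wd [r] y0 < 0"
proof (induction u)
  case (Cons i u)
  have i: "[i] \<in> lists I" and u: "u \<in> lists I" using Cons.prems(1) by auto
  have Y: "wm u y0 \<in> {A..B}" using wm_interval[OF u] y_interval by blast
  show ?case
  proof (cases "wd u y0 < 0")
    case False
    then have "wd [i] (wm u y0) < 0" using Cons.prems(2) by (auto simp: mult_less_0_iff)
    then have "wd [i] y0 < 0" using wd_sign[OF i Y y_interval(1)] by (auto simp: zero_less_mult_iff)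
    then show ?thesis using i by auto
  qed (use Cons.IH[OF u] in blast)
qed auto

text \<open>If the first word reverses orientation, one of its letters does, and this letter is
  appended to both words. Appending on the right only moves the argument within F, so the difference
  bounds survive, while the ratio changes by at most K in one direction and K / m in the
  other.\<close>

lemma preserving_pair:
  assumes near_identity and t: "0 < t" "t \<le> 1"
  obtains i j where "i \<in> lists I" "j \<in> lists I" "0 < wd i y0"
    "\<forall>y\<in>F. 1 / (2 * K\<^sup>2) * t * lam i \<le> wm j y - wm i y"
    "\<forall>y\<in>F. wm j y - wm i y \<le> 3 * K ^ 3 / (2 * m\<^sup>2) * t * lam i"
proof -
  have K: "0 < K" "1 \<le> K" using K_ge_1 by auto
  obtain i j where i: "i \<in> lists I" and j: "j \<in> lists I"
    and lo: "\<forall>y\<in>F. 1 / (2 * K) * t * lam i \<le> wm j y - wm i y"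
    and hi: "\<forall>y\<in>F. wm j y - wm i y \<le> 3 * K\<^sup>2 / (2 * m) * t * lam i"
    using tuned_pair[OF assms] .
  obtain e where e: "e \<in> lists I" "0 < wd (i @ e) y0" "m \<le> lam e" "lam e \<le> 1"
  proof (cases "0 < wd i y0")
    case True
    obtain r where "r \<in> I" using y0 F_eq by blast
    then have "m \<le> 1" using lam_letter[of r] by linarith
    then show ?thesis using that[of "[]"] True by (auto simp: lam_def)
  next
    case False
    then have neg: "wd i y0 < 0" using wd_nonzero[OF i y_interval(1)] by linarith
    then obtain r where r: "r \<in> I" "wd [r] y0 < 0" using wd_neg_letter[OF i] by blast
    have "wm [r] y0 \<in> {A..B}" by (rule wm_interval) (use r y_interval in auto)
    then have "wd i (wm [r] y0) < 0"
      using wd_sign[OF i _ y_interval(1)] neg by (force simp: zero_less_mult_iff)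
    then have "0 < wd (i @ [r]) y0" unfolding wd_append using r by (intro mult_neg_neg)
    then show ?thesis using that[of "[r]"] r lam_letter[of r] by simp
  qed
  have ie: "i @ e \<in> lists I" "j @ e \<in> lists I" using i j e by auto
  have "lam (i @ e) \<le> K * lam i * lam e" by (rule lam_append_upper[OF i e(1)])
  also have "\<dots> \<le> K * lam i * 1" using e K lam_pos[OF i] by (intro mult_left_mono) auto
  finally have "1 / (2 * K\<^sup>2) * t * lam (i @ e) \<le> 1 / (2 * K\<^sup>2) * t * (K * lam i * 1)"
    using K t by (intro mult_left_mono) auto
  also have "\<dots> = 1 / (2 * K) * t * lam i" using K by (simp add: power2_eq_square)
  finally have lo': "1 / (2 * K\<^sup>2) * t * lam (i @ e) \<le> 1 / (2 * K) * t * lam i" .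
  have "lam i * m \<le> lam i * lam e" using e lam_pos[OF i] by (intro mult_left_mono) auto
  also have "\<dots> \<le> K * lam (i @ e)" by (rule lam_append_lower[OF i e(1)])
  finally have "3 * K\<^sup>2 / (2 * m\<^sup>2) * t * (lam i * m) \<le> 3 * K\<^sup>2 / (2 * m\<^sup>2) * t * (K * lam (i @ e))"
    using K t m_pos by (intro mult_left_mono) auto
  then have hi': "3 * K\<^sup>2 / (2 * m) * t * lam i \<le> 3 * K ^ 3 / (2 * m\<^sup>2) * t * lam (i @ e)"
    using m_pos by (simp add: power2_eq_square power3_eq_cube mult_ac)
  have "1 / (2 * K\<^sup>2) * t * lam (i @ e) \<le> wm (j @ e) y - wm (i @ e) y \<and>
      wm (j @ e) y - wm (i @ e) y \<le> 3 * K ^ 3 / (2 * m\<^sup>2) * t * lam (i @ e)" if "y \<in> F" for y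
    using lo hi lo' hi' wm_F[OF e(1) that] unfolding word_map_append by (meson order_trans)
  then show ?thesis using that[OF ie e(2)] by blast
qed

section \<open>Approximate arithmetic progressions\<close>

(* The gaps of the image under any outer word w are measured by the exact derivative at one
   reference point q, so that the chain rule renews the bounds without loss. *)
lemma chain:
  assumes near_identity
  defines "a \<equiv> 1 / (2 * K ^ 4)" and "b \<equiv> 3 * K ^ 5 / (2 * m\<^sup>2)"
  shows "\<exists>\<Delta> q p. 0 < \<Delta> \<and> \<Delta> \<le> 1 \<and> q \<in> F \<and> (\<forall>k\<le>n. p k \<in> F) \<and>
    (\<forall>w\<in>lists I. 0 < wd w y0 \<longrightarrow> (\<forall>k<n. a * \<Delta> * wd w q \<le> wm w (p (Suc k)) - wm w (p k) \<and>
      wm w (p (Suc k)) - wm w (p k) \<le> b * \<Delta> * wd w q))"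
proof (induction n)
  case 0
  show ?case using y0 by (intro exI[of _ 1] exI[of _ y0] exI[of _ "\<lambda>_. y0"]) auto
next
  case (Suc n)
  have K: "0 < K" "1 \<le> K" using K_ge_1 by auto
  obtain \<Delta> q p where \<Delta>: "0 < \<Delta>" "\<Delta> \<le> 1" and q: "q \<in> F" and p: "\<And>k. k \<le> n \<Longrightarrow> p k \<in> F"
    and gap: "\<And>w k. w \<in> lists I \<Longrightarrow> 0 < wd w y0 \<Longrightarrow> k < n \<Longrightarrow>
      a * \<Delta> * wd w q \<le> wm w (p (Suc k)) - wm w (p k) \<and>
      wm w (p (Suc k)) - wm w (p k) \<le> b * \<Delta> * wd w q"
    using Suc.IH by blast
  \<comment> \<open>The parameter t is the current spacing \<Delta>; this is why \<Delta> \<le> 1 is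
    carried through the induction.\<close>
  obtain i j where i: "i \<in> lists I" and j: "j \<in> lists I" and pos: "0 < wd i y0"
    and lo: "\<forall>y\<in>F. 1 / (2 * K\<^sup>2) * \<Delta> * lam i \<le> wm j y - wm i y"
    and hi: "\<forall>y\<in>F. wm j y - wm i y \<le> 3 * K ^ 3 / (2 * m\<^sup>2) * \<Delta> * lam i"
    using preserving_pair[OF assms(1) \<Delta>] .
  have Q: "q \<in> {A..B}" by (rule F_interval[OF q])
  have iq: "0 < wd i q" using wd_pos_iff[OF i Q] pos by simp
  have iq1: "wd i q \<le> 1" using wd_le_1[OF i, of q] Q interval by auto
  \<comment> \<open>With the new reference point \<open>wm i q\<close>, the product \<Delta>' *
    \<open>wd w (wm i q)\<close> is \<Delta> * \<open>wd (w @ i) q\<close>, so the old gaps are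
    covered by the hypothesis for the outer word \<open>w @ i\<close>.\<close>
  define \<Delta>' where "\<Delta>' = \<Delta> * wd i q"
  \<comment> \<open>Both end points of the new gap are images of the same point \<open>p n\<close>,
    so this gap is a difference of the two maps.\<close>
  define p' where "p' = (\<lambda>k. if k \<le> n then wm i (p k) else wm j (p n))"
  have \<Delta>': "0 < \<Delta>'" "\<Delta>' \<le> 1" unfolding \<Delta>'_def using \<Delta> iq iq1 mult_le_one[of \<Delta> "wd i q"] by auto
  have p'F: "p' k \<in> F" if "k \<le> Suc n" for k
    unfolding p'_def using p wm_F i j by auto
  have "a * \<Delta>' * wd w (wm i q) \<le> wm w (p' (Suc k)) - wm w (p' k) \<and>
      wm w (p' (Suc k)) - wm w (p' k) \<le> b * \<Delta>' * wd w (wm i q)"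
    if w: "w \<in> lists I" "0 < wd w y0" and k: "k < Suc n" for w k
  proof (cases "k < n")
    case True
    have wi: "w @ i \<in> lists I" using w i by auto
    have "0 < wd w (wm i y0)" using wd_pos_iff[OF w(1) wm_interval[OF i y_interval(1)]] w(2) by simp
    then have "0 < wd (w @ i) y0" unfolding wd_append using pos by simp
    from gap[OF wi this True] True show ?thesis
      by (simp add: word_map_append wd_append p'_def \<Delta>'_def mult_ac)
  next
    case False
    then have "k = n" using k by simp
    \<comment> \<open>Only the new gap is estimated by distortion: one factor K moves the derivative
      of w from z to \<open>wm i q\<close>, another compares \<open>lam i\<close> with
      \<open>wd i q\<close>. These two factors turn the constants of \<open>preserving_pair\<close>
      into a and b, and they are never paid again for this gap.\<close>
    define x y where "x = wm i (p n)" and "y = wm j (p n)"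
    have xy: "x \<in> {A..B}" "y \<in> {A..B}" unfolding x_def y_def using wm_F[OF i] wm_F[OF j] p F_interval by auto
    have iQ: "wm i q \<in> {A..B}" by (rule wm_interval[OF i Q])
    obtain z where z: "z \<in> {A..B}" "wm w y - wm w x = wd w z * (y - x)" using wm_MVT[OF w(1) xy] .
    have pz: "0 < wd w z" "0 < wd w (wm i q)" using wd_pos_iff[OF w(1)] z(1) iQ w(2) by blast+
    have bd: "wd w z \<le> K * wd w (wm i q)" "wd w (wm i q) \<le> K * wd w z"
      using bounded_distortion[OF w(1) z(1) iQ] bounded_distortion[OF w(1) iQ z(1)] pz by auto
    have bi: "lam i \<le> K * wd i q" "wd i q \<le> K * lam i"
      using lam_le_wd[OF i Q] wd_le_lam[OF i Q] iq by auto
    have yx: "1 / (2 * K\<^sup>2) * \<Delta> * lam i \<le> y - x" "y - x \<le> 3 * K ^ 3 / (2 * m\<^sup>2) * \<Delta> * lam i"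
      unfolding x_def y_def using lo hi p by auto
    have "1 / (2 * K\<^sup>2) * \<Delta> * lam i \<ge> 0" using K \<Delta> lam_pos[OF i] by simp
    then have yx0: "0 \<le> y - x" using yx by linarith
    have "a * \<Delta>' * wd w (wm i q) = (1 / (2 * K ^ 4) * \<Delta>) * (wd w (wm i q) * wd i q)"
      by (simp add: a_def \<Delta>'_def)
    also have "\<dots> \<le> (1 / (2 * K ^ 4) * \<Delta>) * ((K * wd w z) * (K * lam i))"
      using bd bi pz iq K \<Delta> by (intro mult_left_mono mult_mono) auto
    also have "\<dots> = wd w z * (1 / (2 * K\<^sup>2) * \<Delta> * lam i)"
      using K by (simp add: field_simps power4_eq_xxxx power2_eq_square)
    also have "\<dots> \<le> wd w z * (y - x)" using yx pz by (intro mult_left_mono) auto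
    finally have 1: "a * \<Delta>' * wd w (wm i q) \<le> wd w z * (y - x)" .
    have "wd w z * (y - x) \<le> (K * wd w (wm i q)) * (3 * K ^ 3 / (2 * m\<^sup>2) * \<Delta> * (K * wd i q))"
    proof (rule mult_mono)
      have "3 * K ^ 3 / (2 * m\<^sup>2) * \<Delta> * lam i \<le> 3 * K ^ 3 / (2 * m\<^sup>2) * \<Delta> * (K * wd i q)"
        using bi K \<Delta> by (intro mult_left_mono) auto
      then show "y - x \<le> 3 * K ^ 3 / (2 * m\<^sup>2) * \<Delta> * (K * wd i q)" using yx by linarith
    qed (use bd pz K yx0 in auto)
    also have "\<dots> = b * \<Delta>' * wd w (wm i q)"
      by (simp add: b_def \<Delta>'_def eval_nat_numeral mult_ac)
    finally have "wd w z * (y - x) \<le> b * \<Delta>' * wd w (wm i q)" .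
    with 1 show ?thesis using z(2) \<open>k = n\<close> by (simp add: p'_def x_def y_def)
  qed
  then have main: "\<forall>w\<in>lists I. 0 < wd w y0 \<longrightarrow> (\<forall>k<Suc n.
      a * \<Delta>' * wd w (wm i q) \<le> wm w (p' (Suc k)) - wm w (p' k) \<and>
      wm w (p' (Suc k)) - wm w (p' k) \<le> b * \<Delta>' * wd w (wm i q))"
    by (intro ballI allI impI)
  have pF: "\<forall>k\<le>Suc n. p' k \<in> F" using p'F by (intro allI impI)
  show ?case
    by (rule exI[of _ \<Delta>'], rule exI[of _ "wm i q"], rule exI[of _ p'])
      (intro conjI \<Delta>' pF main wm_F[OF i q])
qed

text \<open>The empty outer word has derivative 1.\<close>

lemma approximate_progressions:
  assumes near_identity
  shows "\<exists>\<Delta>>0. \<exists>p. (\<forall>k\<le>n. p k \<in> F) \<and>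
    (\<forall>k<n. 1 / (2 * K ^ 4) * \<Delta> \<le> p (Suc k) - p k \<and> p (Suc k) - p k \<le> 3 * K ^ 5 / (2 * m\<^sup>2) * \<Delta>)"
proof -
  obtain \<Delta> q p where \<Delta>: "0 < \<Delta>" and p: "\<forall>k\<le>n. p k \<in> F"
    and gaps: "\<forall>w\<in>lists I. 0 < wd w y0 \<longrightarrow> (\<forall>k<n.
      1 / (2 * K ^ 4) * \<Delta> * wd w q \<le> wm w (p (Suc k)) - wm w (p k) \<and>
      wm w (p (Suc k)) - wm w (p k) \<le> 3 * K ^ 5 / (2 * m\<^sup>2) * \<Delta> * wd w q)"
    using chain[OF assms, of n] by (elim exE conjE) (rule that)
  have "\<forall>k<n. 1 / (2 * K ^ 4) * \<Delta> \<le> p (Suc k) - p k \<and>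
      p (Suc k) - p k \<le> 3 * K ^ 5 / (2 * m\<^sup>2) * \<Delta>"
    using gaps[rule_format, of "[]"] by simp
  then show ?thesis using \<Delta> p by (intro exI[of _ \<Delta>] exI[of _ p] conjI)
qed

section \<open>The identity limit criterion in terms of contraction ratios\<close>

lemma deriv_wm: "u \<in> lists I \<Longrightarrow> x \<in> \<Omega> \<Longrightarrow> deriv (wm u) x = wd u x"
  using has_deriv_wm by (rule DERIV_imp_deriv)

lemma y0_Omega: "y0 \<in> \<Omega>"
  using y_interval interval by blast

text \<open>Excludes the default \<open>inverse 0 = 0\<close> in the criterion.\<close>

lemma deriv_norm_pos:
  assumes "u \<in> lists I"
  shows "0 < deriv_norm \<Omega> (wm u)"
proof -
  have "\<bar>deriv (wm u) y0\<bar> \<le> deriv_norm \<Omega> (wm u)"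
    unfolding deriv_norm_def
  proof (rule cSUP_upper[OF y0_Omega])
    show "bdd_above ((\<lambda>x. \<bar>deriv (wm u) x\<bar>) ` \<Omega>)"
      using deriv_wm[OF assms] wd_le_1[OF assms] by (intro bdd_aboveI[of _ 1]) auto
  qed
  then show ?thesis using lam_pos[OF assms] deriv_wm[OF assms y0_Omega] by (simp add: lam_def)
qed

lemma deriv_norm_le:
  assumes u: "u \<in> lists I"
  shows "deriv_norm \<Omega> (wm u) \<le> K\<^sup>2 / m * lam u"
  unfolding deriv_norm_def
proof (rule cSUP_least)
  show "\<Omega> \<noteq> {}" using y0_Omega by blast
  fix x assume x: "x \<in> \<Omega>"
  have "\<bar>wd u x\<bar> \<le> K\<^sup>2 / m * lam u"
  proof (cases u rule: rev_cases)
    case Nil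
    obtain r where "r \<in> I" using y0 F_eq by blast
    then have "m \<le> 1" using lam_letter[of r] by linarith
    also have "1 \<le> K\<^sup>2" using K_ge_1 by simp
    finally show ?thesis using Nil m_pos by (simp add: lam_def)
  next
    case (snoc v i)
    then have v: "v \<in> lists I" and i: "i \<in> I" using u by auto
    have "\<bar>wd u x\<bar> = \<bar>wd v (\<phi> i x)\<bar> * \<bar>deriv (\<phi> i) x\<bar>"
      by (simp add: snoc wd_append abs_mult)
    also have "\<dots> \<le> (K * lam v) * 1"
      using wd_le_lam[OF v maps_to[OF i x]] deriv_upper[OF i x] rho_less by (intro mult_mono) auto
    finally have 1: "\<bar>wd u x\<bar> \<le> K * lam v" by simp
    have "lam v * m \<le> lam v * lam [i]"
      using lam_letter(1)[OF i] lam_pos[OF v] by (intro mult_left_mono) auto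
    also have "\<dots> \<le> K * lam u" using lam_append_lower[of v "[i]"] v i snoc by simp
    finally have "K * (lam v * m) \<le> K * (K * lam u)" using K_ge_1 by (intro mult_left_mono) auto
    then have "K * lam v \<le> K\<^sup>2 / m * lam u" using m_pos by (simp add: field_simps power2_eq_square)
    with 1 show ?thesis by linarith
  qed
  then show "\<bar>deriv (wm u) x\<bar> \<le> K\<^sup>2 / m * lam u" using deriv_wm[OF u x] by simp
qed

lemma near_identity_if_not_ILC:
  assumes I: "I = {1..N}" and not: "\<not> identity_limit_criterion N \<Omega> \<phi> F"
  shows near_identity
  unfolding near_identity_def
proof (intro allI impI)
  fix \<epsilon> :: real assume e: "0 < \<epsilon>"
  have words: "words N = lists I" by (simp add: words_def I)
  have K: "0 < K" using K_ge_1 by simp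
  \<comment> \<open>Cancels the factor lost in \<open>deriv_norm_le\<close>.\<close>
  define \<delta> where "\<delta> = \<epsilon> * m / K\<^sup>2"
  have \<delta>: "0 < \<delta>" unfolding \<delta>_def using e m_pos K by simp
  let ?S = "{ereal (inverse (deriv_norm \<Omega> (wm u)) * (SUP x\<in>F. \<bar>wm u x - wm v x\<bar>)) | u v.
      u \<in> words N \<and> v \<in> words N \<and> restrict (wm u) F \<noteq> restrict (wm v) F}"
  have "Inf ?S \<le> 0" using not unfolding identity_limit_criterion_def by (simp only: not_less)
  also have "(0::ereal) < ereal \<delta>" using \<delta> by simp
  finally obtain s where s: "s \<in> ?S" "s < ereal \<delta>" unfolding Inf_less_iff by blast
  then obtain u v where "u \<in> words N" "v \<in> words N" and ne: "restrict (wm u) F \<noteq> restrict (wm v) F"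
    and lt: "inverse (deriv_norm \<Omega> (wm u)) * (SUP x\<in>F. \<bar>wm u x - wm v x\<bar>) < \<delta>"
    by auto
  then have u: "u \<in> lists I" and v: "v \<in> lists I" by (auto simp: words)
  have "(SUP x\<in>F. \<bar>wm u x - wm v x\<bar>) \<le> \<delta> * deriv_norm \<Omega> (wm u)"
    using lt deriv_norm_pos[OF u] by (simp add: field_simps)
  also have "\<dots> \<le> \<delta> * (K\<^sup>2 / m * lam u)"
    using deriv_norm_le[OF u] \<delta> by (intro mult_left_mono) auto
  also have "\<dots> = \<epsilon> * lam u" unfolding \<delta>_def using m_pos K by simp
  finally have sup: "(SUP x\<in>F. \<bar>wm u x - wm v x\<bar>) \<le> \<epsilon> * lam u" .
  \<comment> \<open>Without boundedness the real supremum would not bound the individual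
    differences.\<close>
  have bdd: "bdd_above ((\<lambda>x. \<bar>wm u x - wm v x\<bar>) ` F)"
  proof (rule bdd_aboveI2)
    fix x assume "x \<in> F"
    then have "wm u x \<in> {A..B}" "wm v x \<in> {A..B}" using wm_interval u v F_interval by blast+
    then show "\<bar>wm u x - wm v x\<bar> \<le> B - A" by auto
  qed
  have "\<bar>wm v x - wm u x\<bar> \<le> \<epsilon> * lam u" if "x \<in> F" for x
    using cSUP_upper[OF that bdd] sup by (simp add: abs_minus_commute)
  moreover have "\<exists>x\<in>F. wm u x \<noteq> wm v x" using ne by (meson restrict_ext)
  ultimately show "\<exists>u\<in>lists I. \<exists>v\<in>lists I. (\<exists>x\<in>F. wm u x \<noteq> wm v x) \<and>
      (\<forall>x\<in>F. \<bar>wm v x - wm u x\<bar> \<le> \<epsilon> * lam u)"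
    using u v by blast
qed

lemma assouad_dim_eq_1:
  assumes near_identity
  shows "assouad_dim F = 1"
proof (rule antisym[OF assouad_dim_le_1])
  have "1 \<le> K ^ n" for n using K_ge_1 by simp
  obtain r where "r \<in> I" using y0 F_eq by blast
  then have "m \<le> 1" using lam_letter[of r] by linarith
  then have "m\<^sup>2 \<le> 1" using m_pos by (simp add: power_le_one)
  have "1 / (2 * K ^ 4) \<le> 1 / 2" using \<open>1 \<le> K ^ 4\<close> by (simp add: divide_le_eq)
  also have "1 / 2 \<le> 3 * K ^ 5 / (2 * m\<^sup>2)" using \<open>1 \<le> K ^ 5\<close> \<open>m\<^sup>2 \<le> 1\<close> m_pos by (simp add: field_simps)
  finally have ab: "1 / (2 * K ^ 4) \<le> 3 * K ^ 5 / (2 * m\<^sup>2)" .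
  show "1 \<le> assouad_dim F"
    by (rule assouad_dim_ge_1[OF _ ab approximate_progressions[OF assms]]) (use K_ge_1 in auto)
qed

end

section \<open>Regularity of conformal iterated function systems\<close>

lemma conformal_on_deriv:
  assumes "conformal_on \<Omega> f"
  shows "x \<in> \<Omega> \<Longrightarrow> (f has_real_derivative deriv f x) (at x)" and "continuous_on \<Omega> (deriv f)"
proof -
  obtain D where D: "\<And>x. x \<in> \<Omega> \<Longrightarrow> (f has_vector_derivative D x) (at x)" "continuous_on \<Omega> D"
    using assms unfolding conformal_on_def C1_differentiable_on_def by blast
  have d: "(f has_real_derivative D x) (at x)" if "x \<in> \<Omega>" for x
    using D(1)[OF that] by (simp add: has_real_derivative_iff_has_vector_derivative)
  then have eq: "deriv f x = D x" if "x \<in> \<Omega>" for x using that by (blast intro: DERIV_imp_deriv)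
  show "x \<in> \<Omega> \<Longrightarrow> (f has_real_derivative deriv f x) (at x)" using d eq by simp
  show "continuous_on \<Omega> (deriv f)" using D(2) by (simp cong: continuous_on_cong add: eq)
qed

text \<open>On a bounded set the Hoelder condition bounds the derivative, so the supremum is a
  genuine one.\<close>

lemma conformal_on_le_deriv_norm:
  assumes f: "conformal_on \<Omega> f" and \<Omega>: "bounded \<Omega>" and x: "x \<in> \<Omega>"
  shows "\<bar>deriv f x\<bar> \<le> deriv_norm \<Omega> f"
  unfolding deriv_norm_def
proof (rule cSUP_upper[OF x])
  obtain \<alpha> c where \<alpha>: "\<alpha> > 0" "c > 0"
    and h: "\<And>x y. x \<in> \<Omega> \<Longrightarrow> y \<in> \<Omega> \<Longrightarrow> \<bar>deriv f x - deriv f y\<bar> \<le> c * \<bar>x - y\<bar> powr \<alpha>"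
    using f unfolding conformal_on_def by blast
  show "bdd_above ((\<lambda>x. \<bar>deriv f x\<bar>) ` \<Omega>)"
  proof (rule bdd_aboveI2)
    fix y assume y: "y \<in> \<Omega>"
    have "\<bar>y - x\<bar> powr \<alpha> \<le> diameter \<Omega> powr \<alpha>"
      using \<alpha> diameter_bounded_bound[OF \<Omega> y x] by (intro powr_mono2) (auto simp: dist_real_def)
    then have "c * \<bar>y - x\<bar> powr \<alpha> \<le> c * diameter \<Omega> powr \<alpha>" using \<alpha> by simp
    then show "\<bar>deriv f y\<bar> \<le> \<bar>deriv f x\<bar> + c * diameter \<Omega> powr \<alpha>" using h[OF y x] by linarith
  qed
qed

text \<open>On a bounded set a Hoelder exponent can be lowered at the price of a power of the
  diameter, so finitely many functions share the smallest exponent.\<close>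

lemma common_hoelder:
  fixes g :: "'i \<Rightarrow> real \<Rightarrow> real"
  assumes "finite I" and S: "bounded S"
    and "\<And>i. i \<in> I \<Longrightarrow> \<exists>\<alpha> c. \<alpha> > 0 \<and> c > 0 \<and> (\<forall>x\<in>S. \<forall>y\<in>S. \<bar>g i x - g i y\<bar> \<le> c * \<bar>x - y\<bar> powr \<alpha>)"
  shows "\<exists>\<alpha> c. \<alpha> > 0 \<and> c > 0 \<and>
    (\<forall>i\<in>I. \<forall>x\<in>S. \<forall>y\<in>S. \<bar>g i x - g i y\<bar> \<le> c * \<bar>x - y\<bar> powr \<alpha>)"
  using assms(1,3)
proof (induction I)
  case empty
  show ?case by (intro exI[of _ 1]) auto
next
  case (insert i I)
  obtain \<alpha>1 c1 where 1: "\<alpha>1 > 0" "c1 > 0" "\<forall>x\<in>S. \<forall>y\<in>S. \<bar>g i x - g i y\<bar> \<le> c1 * \<bar>x - y\<bar> powr \<alpha>1"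
    using insert.prems[of i] by auto
  obtain \<alpha>2 c2 where 2: "\<alpha>2 > 0" "c2 > 0" "\<forall>i\<in>I. \<forall>x\<in>S. \<forall>y\<in>S. \<bar>g i x - g i y\<bar> \<le> c2 * \<bar>x - y\<bar> powr \<alpha>2"
    using insert.IH insert.prems by auto
  define \<alpha> where "\<alpha> = min \<alpha>1 \<alpha>2"
  \<comment> \<open>The 1 keeps the powers of \<open>W\<close>, and with them \<open>c\<close>,
    positive when the diameter is 0.\<close>
  define W where "W = max 1 (diameter S)"
  define c where "c = c1 * W powr (\<alpha>1 - \<alpha>) + c2 * W powr (\<alpha>2 - \<alpha>)"
  have W: "1 \<le> W" by (simp add: W_def)
  have c: "c1 * W powr (\<alpha>1 - \<alpha>) \<le> c" "c2 * W powr (\<alpha>2 - \<alpha>) \<le> c" "0 < c"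
    using 1 2 W by (auto simp: c_def intro!: add_pos_pos)
  have weaken: "b * \<bar>x - y\<bar> powr \<beta> \<le> c * \<bar>x - y\<bar> powr \<alpha>"
    if "x \<in> S" "y \<in> S" "\<alpha> \<le> \<beta>" "0 < b" "b * W powr (\<beta> - \<alpha>) \<le> c" for x y \<beta> b
  proof -
    have xy: "\<bar>x - y\<bar> \<le> W" using diameter_bounded_bound[OF S that(1,2)] by (simp add: W_def dist_real_def)
    have "b * \<bar>x - y\<bar> powr \<beta> = b * \<bar>x - y\<bar> powr (\<beta> - \<alpha>) * \<bar>x - y\<bar> powr \<alpha>"
      by (simp add: powr_add[symmetric])
    also have "\<dots> \<le> b * W powr (\<beta> - \<alpha>) * \<bar>x - y\<bar> powr \<alpha>"
      using xy that by (intro mult_right_mono mult_left_mono powr_mono2) auto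
    also have "\<dots> \<le> c * \<bar>x - y\<bar> powr \<alpha>" using that by (intro mult_right_mono) auto
    finally show ?thesis .
  qed
  have "\<bar>g j x - g j y\<bar> \<le> c * \<bar>x - y\<bar> powr \<alpha>" if "j \<in> insert i I" "x \<in> S" "y \<in> S" for j x y
  proof (cases "j = i")
    case True
    then have "\<bar>g j x - g j y\<bar> \<le> c1 * \<bar>x - y\<bar> powr \<alpha>1" using 1(3) that by blast
    also have "\<dots> \<le> c * \<bar>x - y\<bar> powr \<alpha>"
      by (rule weaken) (use that 1 c in \<open>auto simp: \<alpha>_def\<close>)
    finally show ?thesis .
  next
    case False
    then have "\<bar>g j x - g j y\<bar> \<le> c2 * \<bar>x - y\<bar> powr \<alpha>2" using 2(3) that by blast
    also have "\<dots> \<le> c * \<bar>x - y\<bar> powr \<alpha>"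
      by (rule weaken) (use that 2 c in \<open>auto simp: \<alpha>_def\<close>)
    finally show ?thesis .
  qed
  moreover have "0 < \<alpha>" using 1 2 by (simp add: \<alpha>_def)
  ultimately show ?case using c(3) by blast
qed

lemma common_lower_bound:
  fixes g :: "'i \<Rightarrow> 'a::topological_space \<Rightarrow> real"
  assumes "finite I" and S: "compact S"
    and "\<And>i. i \<in> I \<Longrightarrow> continuous_on S (g i)" "\<And>i x. i \<in> I \<Longrightarrow> x \<in> S \<Longrightarrow> g i x \<noteq> 0"
  shows "\<exists>m>0. \<forall>i\<in>I. \<forall>x\<in>S. m \<le> \<bar>g i x\<bar>"
proof (cases "S = {}")
  case False
  from assms(1,3,4) show ?thesis
  proof (induction I)
    case empty
    show ?case by (intro exI[of _ 1]) auto
  next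
    case (insert i I)
    obtain m where m: "m > 0" "\<forall>i\<in>I. \<forall>x\<in>S. m \<le> \<bar>g i x\<bar>"
      using insert.IH insert.prems by auto
    have "continuous_on S (\<lambda>x. \<bar>g i x\<bar>)" using insert.prems(1)[of i] by (intro continuous_intros) auto
    then obtain x where x: "x \<in> S" "\<forall>y\<in>S. \<bar>g i x\<bar> \<le> \<bar>g i y\<bar>"
      using continuous_attains_inf[OF S False] by blast
    have "g i x \<noteq> 0" using insert.prems(2)[of i x] x by simp
    then show ?case using m x by (intro exI[of _ "min m \<bar>g i x\<bar>"]) (auto simp: min_le_iff_disj)
  qed
qed (auto intro: exI[of _ 1])

text \<open>The closures of the images form a compact subset of \<Omega>, and by convexity the
  interval it spans also lies in \<Omega>. It is compact, which bounds the derivatives away from 0,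
  and contains all intermediate points of mean value arguments.\<close>

lemma self_conformal_regular_IFS:
  assumes F: "self_conformal_set N \<Omega> \<phi> F" and y: "y0 \<in> F" "y1 \<in> F" "y0 \<noteq> y1"
  obtains A B m \<rho> c \<alpha> where "regular_IFS {1..N} \<Omega> F \<phi> A B m \<rho> c \<alpha> y0 y1"
proof -
  have \<Omega>: "bounded \<Omega>" "convex \<Omega>" "\<Omega> \<noteq> {}" and N: "N \<ge> 2"
    and conf: "\<And>i. i \<in> {1..N} \<Longrightarrow> conformal_on \<Omega> (\<phi> i)"
    and closure_sub: "\<And>i. i \<in> {1..N} \<Longrightarrow> closure (\<phi> i ` \<Omega>) \<subseteq> \<Omega>"
    and contr: "\<And>i. i \<in> {1..N} \<Longrightarrow> deriv_norm \<Omega> (\<phi> i) < 1"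
    and FF: "compact F" "F \<subseteq> \<Omega>" "F = (\<Union>i\<in>{1..N}. \<phi> i ` F)"
    using F unfolding self_conformal_set_def conformal_IFS_def by auto
  define T where "T = (\<Union>i\<in>{1..N}. closure (\<phi> i ` \<Omega>))"
  have "compact T" unfolding T_def
  proof (rule compact_UN)
    fix i assume "i \<in> {1..N}"
    then have "bounded (\<phi> i ` \<Omega>)" using closure_sub closure_subset \<Omega>(1) by (meson bounded_subset)
    then show "compact (closure (\<phi> i ` \<Omega>))" by simp
  qed simp
  have T_sub: "T \<subseteq> \<Omega>" unfolding T_def using closure_sub by blast
  have in_T: "\<phi> i x \<in> T" if "i \<in> {1..N}" "x \<in> \<Omega>" for i x
    unfolding T_def using that closure_subset by fast
  then have "T \<noteq> {}" using \<Omega>(3) N by fastforce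
  define A B where "A = Inf T" and "B = Sup T"
  have T: "closed T" "bdd_below T" "bdd_above T"
    using compact_imp_closed[OF \<open>compact T\<close>] compact_imp_bounded[OF \<open>compact T\<close>]
    by (auto intro: bounded_imp_bdd_below bounded_imp_bdd_above)
  have "A \<in> T" unfolding A_def by (rule closed_contains_Inf[OF \<open>T \<noteq> {}\<close> T(2,1)])
  have "B \<in> T" unfolding B_def by (rule closed_contains_Sup[OF \<open>T \<noteq> {}\<close> T(3,1)])
  have "closed_segment A B \<subseteq> \<Omega>" using \<open>A \<in> T\<close> \<open>B \<in> T\<close> \<Omega>(2) T_sub by (intro closed_segment_subset) auto
  moreover have "A \<le> B" using \<open>A \<in> T\<close> T cSup_upper[of A T] by (simp add: B_def)
  ultimately have X: "{A..B} \<subseteq> \<Omega>" by (simp add: closed_segment_eq_real_ivl)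
  have T_AB: "T \<subseteq> {A..B}" unfolding A_def B_def using T by (auto intro: cInf_lower cSup_upper)
  obtain \<alpha> c where \<alpha>: "\<alpha> > 0" "c > 0"
    and hoelder: "\<forall>i\<in>{1..N}. \<forall>x\<in>\<Omega>. \<forall>y\<in>\<Omega>. \<bar>deriv (\<phi> i) x - deriv (\<phi> i) y\<bar> \<le> c * \<bar>x - y\<bar> powr \<alpha>"
    using common_hoelder[of "{1..N}" \<Omega> "\<lambda>i. deriv (\<phi> i)"] conf \<Omega>(1)
    unfolding conformal_on_def by auto
  obtain m where m: "m > 0" "\<forall>i\<in>{1..N}. \<forall>x\<in>{A..B}. m \<le> \<bar>deriv (\<phi> i) x\<bar>"
  proof (rule common_lower_bound[of "{1..N}" "{A..B}" "\<lambda>i. deriv (\<phi> i)", THEN exE])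
    fix i assume "i \<in> {1..N}"
    then show "continuous_on {A..B} (deriv (\<phi> i))"
      using conformal_on_deriv(2)[OF conf] X continuous_on_subset by blast
  next
    fix i x assume "i \<in> {1..N}" "x \<in> {A..B}"
    then show "deriv (\<phi> i) x \<noteq> 0" using conf X unfolding conformal_on_def by blast
  qed auto
  \<comment> \<open>The entry 1/2 makes \<rho> positive whatever the norms are.\<close>
  define \<rho> where "\<rho> = Max (insert (1 / 2) ((\<lambda>i. deriv_norm \<Omega> (\<phi> i)) ` {1..N}))"
  have \<rho>: "0 < \<rho>" "\<rho> < 1"
    unfolding \<rho>_def using contr by (auto simp: Max_gr_iff Max_less_iff simp del: Max_insert)
  have norm_le: "deriv_norm \<Omega> (\<phi> i) \<le> \<rho>" if "i \<in> {1..N}" for i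
    unfolding \<rho>_def by (rule Max_ge) (use that in auto)
  have FX: "F \<subseteq> {A..B}"
  proof
    fix x assume "x \<in> F"
    then obtain i y where "i \<in> {1..N}" "y \<in> F" "x = \<phi> i y" using FF(3) by blast
    then show "x \<in> {A..B}" using in_T[of i y] FF(2) T_AB by blast
  qed
  have "regular_IFS {1..N} \<Omega> F \<phi> A B m \<rho> c \<alpha> y0 y1"
  proof
    fix i x assume i: "i \<in> {1..N}" and x: "x \<in> \<Omega>"
    show "\<phi> i x \<in> {A..B}" using in_T[OF i x] T_AB by blast
    show "(\<phi> i has_real_derivative deriv (\<phi> i) x) (at x)"
      by (rule conformal_on_deriv(1)[OF conf[OF i] x])
    show "\<bar>deriv (\<phi> i) x\<bar> \<le> \<rho>"
      using conformal_on_le_deriv_norm[OF conf[OF i] \<Omega>(1) x] norm_le[OF i] by linarith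
  next
    show "\<And>i x y. i \<in> {1..N} \<Longrightarrow> x \<in> {A..B} \<Longrightarrow> y \<in> {A..B} \<Longrightarrow>
        \<bar>deriv (\<phi> i) x - deriv (\<phi> i) y\<bar> \<le> c * \<bar>x - y\<bar> powr \<alpha>"
      using hoelder X by blast
    show "\<And>i x. i \<in> {1..N} \<Longrightarrow> x \<in> {A..B} \<Longrightarrow> m \<le> \<bar>deriv (\<phi> i) x\<bar>" using m by blast
    show "0 \<le> c" using \<alpha> by simp
  qed (fact X \<alpha> m \<rho> FX FF y)+
  then show ?thesis by (rule that)
qed

theorem theorem4p1:
  fixes N :: nat and \<Omega> F :: "real set" and \<phi> :: "nat \<Rightarrow> real \<Rightarrow> real"
  assumes "self_conformal_set N \<Omega> \<phi> F"
    and "\<exists>x\<in>F. \<exists>y\<in>F. x \<noteq> y"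
    and "\<not> identity_limit_criterion N \<Omega> \<phi> F"
  shows "assouad_dim F = 1"
proof -
  obtain y0 y1 where y: "y0 \<in> F" "y1 \<in> F" "y0 \<noteq> y1" using assms(2) by blast
  obtain A B m \<rho> c \<alpha> where "regular_IFS {1..N} \<Omega> F \<phi> A B m \<rho> c \<alpha> y0 y1"
    using self_conformal_regular_IFS[OF assms(1) y] .
  then interpret regular_IFS "{1..N}" \<Omega> F \<phi> A B m \<rho> c \<alpha> y0 y1 .
  show ?thesis by (rule assouad_dim_eq_1[OF near_identity_if_not_ILC[OF refl assms(3)]])
qed

end
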